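(* Let $h=(h_1,\ldots,h_{m_1})$ and $g=(g_1,\ldots,g_{m_2})$ be tuples of polynomials in $\mathbb{R}[x]=\mathbb{R}[x_1,\ldots,x_n]$, let $K=\{x\in\mathbb{R}^n: h(x)=0,\ g(x)\ge 0\}\neq\emptyset$, and let $\mathcal{A}\subseteq\mathbb{N}^n$ be finite. Suppose $I(h)+Q(g)$ is archimedean. If $f\in\mathbb{R}[x]_{\mathcal{A}}$ is positive on $K$, then $$\mathrm{dist}\big(\mathscr{S}_{\mathcal{A}}^k(K,f),\ \mathscr{R}_{\mathcal{A}}(K,f)\big)\to 0\quad\text{as }k\to\infty.$$
   Context: $\mathbb{N}$ is the set of nonnegative integers, $\mathbb{N}^n_d=\{\alpha\in\mathbb{N}^n:|\alpha|\le d\}$ with $|\alpha|=\alpha_1+\cdots+\alpha_n$. For finite $\mathcal{A}\subseteq\mathbb{N}^n$: $\mathbb{R}[x]_{\mathcal{A}}=\mathrm{span}\{x^\alpha:\alpha\in\mathcal{A}\}$; $\mathbb{R}^{\mathcal{A}}$ is the space of real vectors $(y_\alpha)_{\alpha\in\mathcal{A}}$; $\deg(\mathcal{A})=\max\{|\alpha|:\alpha\in\mathcal{A}\}$; $\langle p,y\rangle=\sum_{\alpha\in\mathcal{A}}p_\alpha y_\alpha$ for $p=\sum_{\alpha\in\mathcal{A}}p_\alpha x^\alpha$, $y\in\mathbb{R}^{\mathcal{A}}$. For $z\in\mathbb{R}^{\mathbb{N}^n_{2k}}$, $z|_{\mathcal{A}}$ is its subvector indexed by $\mathcal{A}$, and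 $\mathscr{L}_z(\sum_\alpha p_\alpha x^\alpha)=\sum_\alpha p_\alpha z_\alpha$ for polynomials of degree at most $2k$. $\mathscr{R}_{\mathcal{A}}(K)$ is the set of $y\in\mathbb{R}^{\mathcal{A}}$ for which there is a (nonnegative) Borel measure $\mu$ supported in $K$ with $y_\alpha=\int x^\alpha d\mu$ for all $\alpha\in\mathcal{A}$. $I(h)=h_1\mathbb{R}[x]+\cdots+h_{m_1}\mathbb{R}[x]$, and $Q(g)=\{\sigma_0+\sigma_1g_1+\cdots+\sigma_{m_2}g_{m_2}:\ \sigma_j \text{ sums of squares in }\mathbb{R}[x]\}$. $I(h)+Q(g)$ is archimedean if $R-\|x\|_2^2\in I(h)+Q(g)$ for some $R>0$. For a polynomial $q$ and $z\in\mathbb{R}^{\mathbb{N}^n_{2k}}$, the localizing matrix $L_q^{(k)}(z)$ is the symmetric matrix with $\mathscr{L}_z(qp^2)=p^T L_q^{(k)}(z)\,p$ for all $p\in\mathbb{R}[x]$ with $\deg(qp^2)\le 2k$ (here $p$ also denotes its coefficient vector). With $g_0=1$, let $\Phi_k(g)=\{w\in\mathbb{R}^{\mathbb{N}^n_{2k}}: L_{g_j}^{(k)}(w)\succeq 0,\ j=0,1,\ldots,m_2\}$ and $E_k(h)=\{w\in\mathbb{R}^{\mathbb{N}^n_{2k}}: L_{h_i}^{(k)}(w)=0,\ i=1,\ldots,m_1\}$. $\mathscr{S}_{\mathcal{A}}^k(K)=\{z|_{\mathcal{A}}: z\in\Phi_k(g)\cap E_k(h)\}$ if $k\ge\deg(\mathcal{A})/2$,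 and $\mathscr{S}_{\mathcal{A}}^k(K)=\mathbb{R}^{\mathcal{A}}$ otherwise. One has $\mathscr{R}_{\mathcal{A}}(K)\subseteq\mathscr{S}_{\mathcal{A}}^k(K)$. For $f\in\mathbb{R}[x]_{\mathcal{A}}$: $\mathscr{S}_{\mathcal{A}}^k(K,f)=\{y\in\mathscr{S}_{\mathcal{A}}^k(K):\langle f,y\rangle=1\}$, $\mathscr{R}_{\mathcal{A}}(K,f)=\{y\in\mathscr{R}_{\mathcal{A}}(K):\langle f,y\rangle=1\}$, and $$\mathrm{dist}\big(\mathscr{S}_{\mathcal{A}}^k(K,f),\mathscr{R}_{\mathcal{A}}(K,f)\big)=\sup_{z\in\mathscr{S}_{\mathcal{A}}^k(K,f)}\ \inf_{y\in\mathscr{R}_{\mathcal{A}}(K,f)}\|z-y\|_2\in[0,\infty].$$ *)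

theory Defs
  imports "HOL-Analysis.Analysis" "HOL-Library.Poly_Mapping"
begin

text \<open>
  The number \<open>n\<close> of variables is the cardinality of the finite type \<open>'n\<close>.  A polynomial is the
  finitely supported map sending an exponent vector to its coefficient; the ring structure
  (multiplication is convolution) is the one of the theory of finitely supported maps.
\<close>

type_synonym 'n expo = "nat ^ 'n"
type_synonym 'n rpoly = "'n expo \<Rightarrow>\<^sub>0 real"

definition expo_deg :: "'n::finite expo \<Rightarrow> nat" where
  "expo_deg \<alpha> = (\<Sum>i\<in>UNIV. \<alpha> $ i)"

definition expos_upto :: "nat \<Rightarrow> 'n::finite expo set" where
  "expos_upto d = {\<alpha>. expo_deg \<alpha> \<le> d}"

definition set_deg :: "'n::finite expo set \<Rightarrow> nat" where
  "set_deg A = Max (expo_deg ` A)"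

definition monomial :: "'n::finite expo \<Rightarrow> 'n rpoly" where
  "monomial \<alpha> = Poly_Mapping.single \<alpha> 1"

definition pconst :: "real \<Rightarrow> 'n::finite rpoly" where
  "pconst c = Poly_Mapping.single 0 c"

definition pvar :: "'n::finite \<Rightarrow> 'n rpoly" where
  "pvar i = monomial (axis i 1)"

text \<open>The zero polynomial gets degree 0.\<close>

definition pdeg :: "'n::finite rpoly \<Rightarrow> nat" where
  "pdeg p = Max (insert 0 (expo_deg ` Poly_Mapping.keys p))"

definition monomial_eval :: "'n::finite expo \<Rightarrow> real ^ 'n \<Rightarrow> real" where
  "monomial_eval \<alpha> x = (\<Prod>i\<in>UNIV. (x $ i) ^ (\<alpha> $ i))"

definition peval :: "'n::finite rpoly \<Rightarrow> real ^ 'n \<Rightarrow> real" where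
  "peval p x = (\<Sum>\<alpha>\<in>Poly_Mapping.keys p. Poly_Mapping.lookup p \<alpha> * monomial_eval \<alpha> x)"

definition poly_span :: "'n::finite expo set \<Rightarrow> 'n rpoly set" where
  "poly_span A = {\<Sum>\<alpha>\<in>A. pconst (c \<alpha>) * monomial \<alpha> | c. True}"

text \<open>
  The space \<open>\<real>\<^sup>A\<close> is represented by the extensional functions on \<open>A\<close>, and the subvector
  \<open>z|\<^sub>A\<close> by \<open>restrict z A\<close>.
\<close>

abbreviation real_vecs :: "'a set \<Rightarrow> ('a \<Rightarrow> real) set" where
  "real_vecs A \<equiv> A \<rightarrow>\<^sub>E (UNIV :: real set)"

definition pairing :: "'n::finite expo set \<Rightarrow> 'n rpoly \<Rightarrow> ('n expo \<Rightarrow> real) \<Rightarrow> real" where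
  "pairing A p y = (\<Sum>\<alpha>\<in>A. Poly_Mapping.lookup p \<alpha> * y \<alpha>)"

definition riesz :: "('n::finite expo \<Rightarrow> real) \<Rightarrow> 'n rpoly \<Rightarrow> real" where
  "riesz z p = (\<Sum>\<alpha>\<in>Poly_Mapping.keys p. Poly_Mapping.lookup p \<alpha> * z \<alpha>)"

definition semialg :: "'n::finite rpoly list \<Rightarrow> 'n rpoly list \<Rightarrow> (real ^ 'n) set" where
  "semialg h g = {x. (\<forall>p\<in>set h. peval p x = 0) \<and> (\<forall>p\<in>set g. peval p x \<ge> 0)}"

definition poly_ideal :: "'n::finite rpoly list \<Rightarrow> 'n rpoly set" where
  "poly_ideal h = {\<Sum>i<length h. h ! i * p i | p. True}"

definition sos :: "'n::finite rpoly \<Rightarrow> bool" where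
  "sos p \<longleftrightarrow> (\<exists>qs. p = (\<Sum>q\<leftarrow>qs. q ^ 2))"

definition quad_module :: "'n::finite rpoly list \<Rightarrow> 'n rpoly set" where
  "quad_module g = {\<sigma>0 + (\<Sum>j<length g. \<sigma> j * g ! j) | \<sigma>0 \<sigma>. sos \<sigma>0 \<and> (\<forall>j<length g. sos (\<sigma> j))}"

definition archimedean :: "'n::finite rpoly list \<Rightarrow> 'n rpoly list \<Rightarrow> bool" where
  "archimedean h g \<longleftrightarrow>
     (\<exists>R>0. \<exists>a\<in>poly_ideal h. \<exists>b\<in>quad_module g. pconst R - (\<Sum>i\<in>UNIV. pvar i ^ 2) = a + b)"

text \<open>
  \<open>semialg h g\<close> is closed (see \<open>closed_semialg\<close> below), hence Borel, so a Borel measure is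
  supported in it iff the complement is a null set.  The measure need not be finite;
  integrability of the monomials is part of the requirement that the moments exist.
\<close>

definition moment_cone :: "'n::finite expo set \<Rightarrow> (real ^ 'n) set \<Rightarrow> ('n expo \<Rightarrow> real) set" where
  "moment_cone A K = {y \<in> real_vecs A. \<exists>\<mu>. sets \<mu> = sets borel \<and> emeasure \<mu> (- K) = 0 \<and>
     (\<forall>\<alpha>\<in>A. integrable \<mu> (monomial_eval \<alpha>) \<and> y \<alpha> = integral\<^sup>L \<mu> (monomial_eval \<alpha>))}"

text \<open>
  Matrices with rows and columns indexed by \<open>I\<close> are extensional functions on \<open>I \<times> I\<close>.
  Row and column indices of the localizing matrix of \<open>q\<close> are the exponents \<open>\<alpha>\<close> with
  \<open>deg q + 2|\<alpha>| \<le> 2k\<close>, that is, the exponents of the polynomials \<open>p\<close> with \<open>deg (qp\<^sup>2) \<le> 2k\<close>;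
  there are none if \<open>deg q > 2k\<close>.
\<close>

definition symmetric_on :: "'a set \<Rightarrow> ('a \<times> 'a \<Rightarrow> real) \<Rightarrow> bool" where
  "symmetric_on I M \<longleftrightarrow> (\<forall>a\<in>I. \<forall>b\<in>I. M (a, b) = M (b, a))"

definition quad_form :: "'a set \<Rightarrow> ('a \<times> 'a \<Rightarrow> real) \<Rightarrow> ('a \<Rightarrow> real) \<Rightarrow> real" where
  "quad_form I M v = (\<Sum>a\<in>I. \<Sum>b\<in>I. v a * M (a, b) * v b)"

definition psd_on :: "'a set \<Rightarrow> ('a \<times> 'a \<Rightarrow> real) \<Rightarrow> bool" where
  "psd_on I M \<longleftrightarrow> symmetric_on I M \<and> (\<forall>v. quad_form I M v \<ge> 0)"

definition loc_index :: "'n::finite rpoly \<Rightarrow> nat \<Rightarrow> 'n expo set" where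
  "loc_index q k = {\<alpha>. pdeg q + 2 * expo_deg \<alpha> \<le> 2 * k}"

definition is_loc_matrix ::
  "'n::finite rpoly \<Rightarrow> nat \<Rightarrow> ('n expo \<Rightarrow> real) \<Rightarrow> ('n expo \<times> 'n expo \<Rightarrow> real) \<Rightarrow> bool" where
  "is_loc_matrix q k z M \<longleftrightarrow>
     M \<in> real_vecs (loc_index q k \<times> loc_index q k) \<and> symmetric_on (loc_index q k) M \<and>
     (\<forall>p. pdeg (q * p ^ 2) \<le> 2 * k \<longrightarrow>
        riesz z (q * p ^ 2) = quad_form (loc_index q k) M (Poly_Mapping.lookup p))"

text \<open>
  Existence and uniqueness, together with the entries \<open>riesz z (q * monomial (\<alpha> + \<beta>))\<close>, are proved
  in \<open>is_loc_matrix_iff\<close> and \<open>loc_matrix_entry\<close> below.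
\<close>

definition loc_matrix ::
  "'n::finite rpoly \<Rightarrow> nat \<Rightarrow> ('n expo \<Rightarrow> real) \<Rightarrow> ('n expo \<times> 'n expo \<Rightarrow> real)" where
  "loc_matrix q k z = (THE M. is_loc_matrix q k z M)"

definition Phi_set :: "nat \<Rightarrow> 'n::finite rpoly list \<Rightarrow> ('n expo \<Rightarrow> real) set" where
  "Phi_set k g = {w \<in> real_vecs (expos_upto (2 * k)).
     \<forall>q\<in>set (1 # g). psd_on (loc_index q k) (loc_matrix q k w)}"

definition E_set :: "nat \<Rightarrow> 'n::finite rpoly list \<Rightarrow> ('n expo \<Rightarrow> real) set" where
  "E_set k h = {w \<in> real_vecs (expos_upto (2 * k)).
     \<forall>q\<in>set h. \<forall>\<alpha>\<in>loc_index q k. \<forall>\<beta>\<in>loc_index q k. loc_matrix q k w (\<alpha>, \<beta>) = 0}"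

definition S_relax ::
  "'n::finite rpoly list \<Rightarrow> 'n rpoly list \<Rightarrow> 'n expo set \<Rightarrow> nat \<Rightarrow> ('n expo \<Rightarrow> real) set" where
  "S_relax h g A k =
     (if real k \<ge> real (set_deg A) / 2
      then {restrict z A | z. z \<in> Phi_set k g \<inter> E_set k h}
      else real_vecs A)"

definition S_section ::
  "'n::finite rpoly list \<Rightarrow> 'n rpoly list \<Rightarrow> 'n expo set \<Rightarrow> nat \<Rightarrow> 'n rpoly \<Rightarrow> ('n expo \<Rightarrow> real) set" where
  "S_section h g A k f = {y \<in> S_relax h g A k. pairing A f y = 1}"

definition R_section ::
  "'n::finite expo set \<Rightarrow> (real ^ 'n) set \<Rightarrow> 'n rpoly \<Rightarrow> ('n expo \<Rightarrow> real) set" where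
  "R_section A K f = {y \<in> moment_cone A K. pairing A f y = 1}"

definition set_dist :: "'a set \<Rightarrow> ('a \<Rightarrow> real) set \<Rightarrow> ('a \<Rightarrow> real) set \<Rightarrow> ennreal" where
  "set_dist A S R = (SUP z\<in>S. INF y\<in>R. ennreal (L2_set (\<lambda>\<alpha>. z \<alpha> - y \<alpha>) A))"


subsection \<open>The feasible set is closed\<close>

lemma continuous_on_peval: "continuous_on UNIV (peval p)"
  unfolding peval_def monomial_eval_def by (intro continuous_intros)

lemma closed_semialg: "closed (semialg h g)"
proof -
  have "semialg h g = (\<Inter>p\<in>set h. {x. peval p x = 0}) \<inter> (\<Inter>p\<in>set g. {x. 0 \<le> peval p x})"
    by (auto simp: semialg_def)
  also have "closed \<dots>"
    by (intro closed_Int closed_INT ballI closed_Collect_eq closed_Collect_le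
        continuous_on_peval continuous_on_const)
  finally show ?thesis .
qed


subsection \<open>Degrees\<close>

lemma expo_deg_add: "expo_deg (\<alpha> + \<beta>) = expo_deg \<alpha> + expo_deg \<beta>"
  by (simp add: expo_deg_def sum.distrib)

lemma finite_expos_upto: "finite (expos_upto d :: 'n::finite expo set)"
proof (rule finite_subset)
  show "expos_upto d \<subseteq> vec_lambda ` (UNIV \<rightarrow>\<^sub>E {..d} :: ('n \<Rightarrow> nat) set)"
  proof
    fix \<alpha> :: "'n expo" assume "\<alpha> \<in> expos_upto d"
    then have "\<alpha> $ i \<le> d" for i
      using member_le_sum[of i UNIV "\<lambda>i. \<alpha> $ i"] by (simp add: expos_upto_def expo_deg_def)
    then show "\<alpha> \<in> vec_lambda ` (UNIV \<rightarrow>\<^sub>E {..d})"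
      by (intro image_eqI[of _ _ "vec_nth \<alpha>"]) auto
  qed
  show "finite (vec_lambda ` (UNIV \<rightarrow>\<^sub>E {..d}) :: 'n expo set)"
    by (intro finite_imageI finite_PiE) auto
qed

lemma finite_loc_index: "finite (loc_index q k)"
  by (rule finite_subset[OF _ finite_expos_upto[of k]]) (auto simp: loc_index_def expos_upto_def)

lemma expo_deg_le_pdeg: "\<alpha> \<in> Poly_Mapping.keys p \<Longrightarrow> expo_deg \<alpha> \<le> pdeg p"
  unfolding pdeg_def by (intro Max_ge) auto

lemma pdeg_le: "(\<And>\<alpha>. \<alpha> \<in> Poly_Mapping.keys p \<Longrightarrow> expo_deg \<alpha> \<le> d) \<Longrightarrow> pdeg p \<le> d"
  unfolding pdeg_def by (subst Max_le_iff) auto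

lemma pdeg_mult_le: "pdeg (p * q) \<le> pdeg p + pdeg q"
proof (rule pdeg_le)
  fix \<gamma> assume "\<gamma> \<in> Poly_Mapping.keys (p * q)"
  then obtain \<alpha> \<beta> where "\<gamma> = \<alpha> + \<beta>" "\<alpha> \<in> Poly_Mapping.keys p" "\<beta> \<in> Poly_Mapping.keys q"
    using keys_mult[of p q] by auto
  then show "expo_deg \<gamma> \<le> pdeg p + pdeg q"
    using expo_deg_le_pdeg[of \<alpha> p] expo_deg_le_pdeg[of \<beta> q] by (simp add: expo_deg_add)
qed

lemma lookup_mult_keys:
  "Poly_Mapping.lookup (p * q) \<gamma> = (\<Sum>\<alpha>\<in>Poly_Mapping.keys p. \<Sum>\<beta>\<in>Poly_Mapping.keys q.
     (if \<gamma> = \<alpha> + \<beta> then Poly_Mapping.lookup p \<alpha> * Poly_Mapping.lookup q \<beta> else 0))"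
proof -
  have "(\<Sum>\<beta>. Poly_Mapping.lookup q \<beta> when \<gamma> = \<alpha> + \<beta>) =
      (\<Sum>\<beta>\<in>Poly_Mapping.keys q. Poly_Mapping.lookup q \<beta> when \<gamma> = \<alpha> + \<beta>)" for \<alpha>
    by (rule Sum_any.expand_superset) (auto simp: in_keys_iff)
  then have "Poly_Mapping.lookup (p * q) \<gamma> =
     (\<Sum>\<alpha>. Poly_Mapping.lookup p \<alpha> * (\<Sum>\<beta>\<in>Poly_Mapping.keys q. Poly_Mapping.lookup q \<beta> when \<gamma> = \<alpha> + \<beta>))"
    by (simp add: lookup_mult)
  also have "\<dots> = (\<Sum>\<alpha>\<in>Poly_Mapping.keys p. Poly_Mapping.lookup p \<alpha> *
      (\<Sum>\<beta>\<in>Poly_Mapping.keys q. Poly_Mapping.lookup q \<beta> when \<gamma> = \<alpha> + \<beta>))"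
    by (rule Sum_any.expand_superset) (auto simp: in_keys_iff)
  finally show ?thesis
    by (auto simp: sum_distrib_left when_def intro!: sum.cong)
qed

text \<open>An additive injection of the exponents into a linearly ordered monoid that refines the degree.\<close>

definition gr_key :: "'n::finite expo \<Rightarrow> (nat \<Rightarrow>\<^sub>0 nat)" where
  "gr_key \<alpha> = Poly_Mapping.single 0 (expo_deg \<alpha>) +
     (\<Sum>i\<in>UNIV. Poly_Mapping.single (Suc (to_nat_on UNIV i)) (\<alpha> $ i))"

lemma gr_key_add: "gr_key (\<alpha> + \<beta>) = gr_key \<alpha> + gr_key \<beta>"
  by (simp add: gr_key_def expo_deg_add single_add sum.distrib algebra_simps)

lemma lookup_gr_key_0: "Poly_Mapping.lookup (gr_key \<alpha>) 0 = expo_deg \<alpha>"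
  by (simp add: gr_key_def lookup_add lookup_sum lookup_single)

lemma lookup_gr_key_Suc:
  "Poly_Mapping.lookup (gr_key (\<alpha> :: 'n::finite expo)) (Suc (to_nat_on UNIV i)) = \<alpha> $ i"
proof -
  have "to_nat_on (UNIV :: 'n set) j = to_nat_on UNIV i \<longleftrightarrow> j = i" for j
    by (simp add: countable_finite)
  then show ?thesis
    by (simp add: gr_key_def lookup_add lookup_sum lookup_single when_def)
qed

lemma gr_key_inj: "gr_key \<alpha> = gr_key \<beta> \<Longrightarrow> \<alpha> = \<beta>"
  by (metis lookup_gr_key_Suc vec_eq_iff)

lemma gr_key_le_imp:
  fixes \<alpha> \<beta> :: "'n::finite expo"
  assumes "gr_key \<alpha> \<le> gr_key \<beta>"
  shows "expo_deg \<alpha> \<le> expo_deg \<beta>"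
proof -
  from assms have "less_fun (Poly_Mapping.lookup (gr_key \<alpha>)) (Poly_Mapping.lookup (gr_key \<beta>)) \<or>
      gr_key \<alpha> = gr_key \<beta>"
    by (auto simp only: less_eq_poly_mapping.rep_eq lookup_inject)
  then show ?thesis
  proof
    assume "less_fun (Poly_Mapping.lookup (gr_key \<alpha>)) (Poly_Mapping.lookup (gr_key \<beta>))"
    then obtain k where k: "Poly_Mapping.lookup (gr_key \<alpha>) k < Poly_Mapping.lookup (gr_key \<beta>) k"
      "\<And>k'. k' < k \<Longrightarrow> Poly_Mapping.lookup (gr_key \<alpha>) k' = Poly_Mapping.lookup (gr_key \<beta>) k'"
      by (auto simp: less_fun_def)
    then have "Poly_Mapping.lookup (gr_key \<alpha>) 0 \<le> Poly_Mapping.lookup (gr_key \<beta>) 0"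
      by (cases "k = 0") auto
    then show ?thesis by (simp add: lookup_gr_key_0)
  next
    assume "gr_key \<alpha> = gr_key \<beta>"
    then have "\<alpha> = \<beta>" by (rule gr_key_inj)
    then show ?thesis by simp
  qed
qed

lemma leading_expo:
  assumes "p \<noteq> 0"
  obtains \<alpha> where "\<alpha> \<in> Poly_Mapping.keys p" "expo_deg \<alpha> = pdeg p"
    "\<And>\<beta>. \<beta> \<in> Poly_Mapping.keys p \<Longrightarrow> gr_key \<beta> \<le> gr_key \<alpha>"
proof -
  let ?S = "gr_key ` Poly_Mapping.keys p"
  have S: "finite ?S" "?S \<noteq> {}" using assms by auto
  obtain \<alpha> where \<alpha>: "\<alpha> \<in> Poly_Mapping.keys p" "gr_key \<alpha> = Max ?S"
  proof -
    from Max_in[OF S] obtain \<alpha> where "\<alpha> \<in> Poly_Mapping.keys p" "Max ?S = gr_key \<alpha>" ..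
    then show thesis by (intro that) simp_all
  qed
  have le: "gr_key \<beta> \<le> gr_key \<alpha>" if "\<beta> \<in> Poly_Mapping.keys p" for \<beta>
    using S that \<alpha>(2) by auto
  have "expo_deg \<alpha> = pdeg p"
    using expo_deg_le_pdeg[OF \<alpha>(1)] pdeg_le[of p "expo_deg \<alpha>"] gr_key_le_imp[OF le] by fastforce
  then show ?thesis using that \<alpha>(1) le by blast
qed

lemma pdeg_mult:
  assumes "p \<noteq> 0" "q \<noteq> 0"
  shows "p * q \<noteq> 0" "pdeg (p * q) = pdeg p + pdeg q"
proof -
  obtain \<alpha> where \<alpha>: "\<alpha> \<in> Poly_Mapping.keys p" "expo_deg \<alpha> = pdeg p"
    "\<And>\<beta>. \<beta> \<in> Poly_Mapping.keys p \<Longrightarrow> gr_key \<beta> \<le> gr_key \<alpha>"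
    using leading_expo[OF assms(1)] by blast
  obtain \<beta> where \<beta>: "\<beta> \<in> Poly_Mapping.keys q" "expo_deg \<beta> = pdeg q"
    "\<And>\<gamma>. \<gamma> \<in> Poly_Mapping.keys q \<Longrightarrow> gr_key \<gamma> \<le> gr_key \<beta>"
    using leading_expo[OF assms(2)] by blast
  have uniq: "a = \<alpha> \<and> b = \<beta>"
    if "a \<in> Poly_Mapping.keys p" "b \<in> Poly_Mapping.keys q" "\<alpha> + \<beta> = a + b" for a b
  proof -
    have "gr_key a + gr_key b = gr_key \<alpha> + gr_key \<beta>"
      using that(3) by (metis gr_key_add)
    moreover have "gr_key a \<le> gr_key \<alpha>" "gr_key b \<le> gr_key \<beta>"
      using \<alpha>(3) \<beta>(3) that by auto
    ultimately have "gr_key a = gr_key \<alpha>"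
      by (metis add_less_le_mono order_less_irrefl order_le_less)
    then have "a = \<alpha>" by (rule gr_key_inj)
    then show ?thesis using that(3) by simp
  qed
  have "Poly_Mapping.lookup (p * q) (\<alpha> + \<beta>) =
      (\<Sum>a\<in>Poly_Mapping.keys p. \<Sum>b\<in>Poly_Mapping.keys q.
         if a = \<alpha> then if b = \<beta> then Poly_Mapping.lookup p \<alpha> * Poly_Mapping.lookup q \<beta> else 0 else 0)"
    unfolding lookup_mult_keys by (intro sum.cong refl) (use uniq in auto)
  also have "\<dots> = Poly_Mapping.lookup p \<alpha> * Poly_Mapping.lookup q \<beta>"
  proof -
    have "(\<Sum>b\<in>Poly_Mapping.keys q. if a = \<alpha> then if b = \<beta> then Poly_Mapping.lookup p \<alpha> *
        Poly_Mapping.lookup q \<beta> else 0 else 0) =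
        (if a = \<alpha> then Poly_Mapping.lookup p \<alpha> * Poly_Mapping.lookup q \<beta> else 0)" for a
      using \<beta>(1) by (cases "a = \<alpha>") auto
    then show ?thesis using \<alpha>(1) by simp
  qed
  also have "\<dots> \<noteq> 0" using \<alpha>(1) \<beta>(1) by (simp add: in_keys_iff)
  finally have key: "\<alpha> + \<beta> \<in> Poly_Mapping.keys (p * q)" by (simp add: in_keys_iff)
  then show "p * q \<noteq> 0" by auto
  show "pdeg (p * q) = pdeg p + pdeg q"
    using expo_deg_le_pdeg[OF key] pdeg_mult_le[of p q] \<alpha>(2) \<beta>(2) by (simp add: expo_deg_add)
qed


subsection \<open>The localizing matrix exists, is unique, and has the expected entries\<close>

lemma riesz_superset:
  assumes "finite B" "Poly_Mapping.keys p \<subseteq> B"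
  shows "riesz z p = (\<Sum>\<alpha>\<in>B. Poly_Mapping.lookup p \<alpha> * z \<alpha>)"
  unfolding riesz_def using assms by (intro sum.mono_neutral_left) (auto simp: in_keys_iff)

lemma riesz_zero: "riesz z 0 = 0"
  by (simp add: riesz_def)

lemma riesz_add: "riesz z (p + q) = riesz z p + riesz z q"
proof -
  let ?B = "Poly_Mapping.keys p \<union> Poly_Mapping.keys q"
  have "Poly_Mapping.keys (p + q) \<subseteq> ?B" by (rule keys_add)
  then show ?thesis
    by (simp add: riesz_superset[of ?B] lookup_add distrib_right sum.distrib)
qed

lemma riesz_sum: "riesz z (\<Sum>i\<in>I. p i) = (\<Sum>i\<in>I. riesz z (p i))"
  by (induction I rule: infinite_finite_induct) (simp_all add: riesz_zero riesz_add)

lemma lookup_pconst_mult: "Poly_Mapping.lookup (pconst c * p) \<alpha> = c * Poly_Mapping.lookup p \<alpha>"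
proof -
  have "Poly_Mapping.lookup (Poly_Mapping.map ((*) c) p) \<alpha> = c * Poly_Mapping.lookup p \<alpha>"
    by transfer (auto simp: when_def)
  then show ?thesis by (simp add: pconst_def mult_map_scale_conv_mult)
qed

lemma riesz_pconst_mult: "riesz z (pconst c * p) = c * riesz z p"
proof -
  have "Poly_Mapping.keys (pconst c * p) \<subseteq> Poly_Mapping.keys p"
    by (auto simp: in_keys_iff lookup_pconst_mult)
  then show ?thesis
    by (simp add: riesz_superset[of "Poly_Mapping.keys p"] lookup_pconst_mult sum_distrib_left mult.assoc)
qed

lemma poly_expand:
  assumes "finite B" "Poly_Mapping.keys p \<subseteq> B"
  shows "p = (\<Sum>\<alpha>\<in>B. pconst (Poly_Mapping.lookup p \<alpha>) * monomial \<alpha>)"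
proof (rule poly_mapping_eqI)
  fix \<beta>
  have "(\<Sum>\<alpha>\<in>B. Poly_Mapping.lookup (pconst (Poly_Mapping.lookup p \<alpha>) * monomial \<alpha>) \<beta>) =
      (\<Sum>\<alpha>\<in>B. if \<alpha> = \<beta> then Poly_Mapping.lookup p \<beta> else 0)"
    by (intro sum.cong refl) (auto simp: lookup_pconst_mult monomial_def lookup_single when_def)
  also have "\<dots> = Poly_Mapping.lookup p \<beta>"
    using assms by (auto simp: in_keys_iff)
  finally show "Poly_Mapping.lookup p \<beta> =
      Poly_Mapping.lookup (\<Sum>\<alpha>\<in>B. pconst (Poly_Mapping.lookup p \<alpha>) * monomial \<alpha>) \<beta>"
    by (simp add: lookup_sum)
qed

lemma poly_span_iff:
  assumes "finite A"
  shows "p \<in> poly_span A \<longleftrightarrow> Poly_Mapping.keys p \<subseteq> A"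
proof
  assume "p \<in> poly_span A"
  then obtain c where c: "p = (\<Sum>\<alpha>\<in>A. pconst (c \<alpha>) * monomial \<alpha>)"
    by (auto simp: poly_span_def)
  have "Poly_Mapping.lookup p \<beta> = 0" if "\<beta> \<notin> A" for \<beta>
    unfolding c lookup_sum
    by (rule sum.neutral) (use that in \<open>auto simp: lookup_pconst_mult monomial_def lookup_single when_def\<close>)
  then show "Poly_Mapping.keys p \<subseteq> A" by (auto simp: in_keys_iff)
next
  assume "Poly_Mapping.keys p \<subseteq> A"
  then show "p \<in> poly_span A"
    using poly_expand[OF assms] unfolding poly_span_def by blast
qed

lemma monomial_mult: "monomial \<alpha> * monomial \<beta> = monomial (\<alpha> + \<beta>)"
  by (simp add: monomial_def mult_single)

lemma riesz_square:
  assumes "finite B" "Poly_Mapping.keys p \<subseteq> B"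
  shows "riesz z (q * p ^ 2) =
    quad_form B (\<lambda>(\<alpha>, \<beta>). riesz z (q * monomial (\<alpha> + \<beta>))) (Poly_Mapping.lookup p)"
proof -
  let ?c = "Poly_Mapping.lookup p"
  have "q * p ^ 2 = q * ((\<Sum>\<alpha>\<in>B. pconst (?c \<alpha>) * monomial \<alpha>) * (\<Sum>\<beta>\<in>B. pconst (?c \<beta>) * monomial \<beta>))"
    using poly_expand[OF assms] by (simp add: power2_eq_square)
  also have "\<dots> = (\<Sum>\<alpha>\<in>B. \<Sum>\<beta>\<in>B. pconst (?c \<alpha>) * (pconst (?c \<beta>) * (q * monomial (\<alpha> + \<beta>))))"
    by (simp add: sum_product sum_distrib_left monomial_mult[symmetric] mult_ac)
  finally have eq: "q * p ^ 2 =
    (\<Sum>\<alpha>\<in>B. \<Sum>\<beta>\<in>B. pconst (?c \<alpha>) * (pconst (?c \<beta>) * (q * monomial (\<alpha> + \<beta>))))" .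
  show ?thesis
    unfolding eq quad_form_def riesz_sum riesz_pconst_mult
    by (intro sum.cong refl) simp
qed

lemma keys_subset_loc_index:
  assumes "q \<noteq> 0" "pdeg (q * p ^ 2) \<le> 2 * k"
  shows "Poly_Mapping.keys p \<subseteq> loc_index q k"
proof (cases "p = 0")
  case False
  have "pdeg (q * p ^ 2) = pdeg q + 2 * pdeg p"
    using pdeg_mult[OF False False] pdeg_mult(2)[OF assms(1), of "p * p"]
    by (simp add: power2_eq_square)
  then show ?thesis
    using assms(2) expo_deg_le_pdeg[of _ p] by (fastforce simp: loc_index_def)
qed simp

lemma pdeg_le_of_loc_index:
  assumes "Poly_Mapping.keys p \<subseteq> loc_index q k" "loc_index q k \<noteq> {}"
  shows "pdeg (q * p ^ 2) \<le> 2 * k"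
proof -
  from assms(2) have q: "pdeg q \<le> 2 * k" by (auto simp: loc_index_def)
  have "pdeg p \<le> (2 * k - pdeg q) div 2"
    by (rule pdeg_le) (use assms(1) in \<open>auto simp: loc_index_def\<close>)
  moreover have "pdeg (q * p ^ 2) \<le> pdeg q + (pdeg p + pdeg p)"
    using pdeg_mult_le[of q "p * p"] pdeg_mult_le[of p p] by (simp add: power2_eq_square)
  ultimately show ?thesis using q by linarith
qed

lemma quad_form_two:
  assumes "finite I" "a \<in> I" "b \<in> I" "a \<noteq> b" "symmetric_on I M"
  shows "quad_form I M (\<lambda>x. if x = a \<or> x = b then 1 else 0) = M (a, a) + 2 * M (a, b) + M (b, b)"
proof -
  have *: "(\<Sum>x\<in>I. (if x = c then 1 else 0) * f x) = f c" if "c \<in> I" for c and f :: "_ \<Rightarrow> real"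
    using assms(1) that by (simp add: if_distrib[of "\<lambda>u. u * _"] cong: if_cong)
  have qf: "quad_form I M v = (\<Sum>x\<in>I. v x * (\<Sum>y\<in>I. v y * M (x, y)))" for v
    unfolding quad_form_def by (simp add: sum_distrib_left mult_ac)
  have **: "(if x = a \<or> x = b then 1 else 0 :: real) * t =
      (if x = a then 1 else 0) * t + (if x = b then 1 else 0) * t" for x t
    using assms(4) by auto
  have "M (b, a) = M (a, b)" using assms by (auto simp: symmetric_on_def)
  then show "quad_form I M (\<lambda>x. if x = a \<or> x = b then 1 else 0) = M (a, a) + 2 * M (a, b) + M (b, b)"
    unfolding qf ** sum.distrib using assms(2,3) by (simp add: *)
qed

lemma quad_form_one:
  assumes "finite I" "a \<in> I"
  shows "quad_form I M (\<lambda>x. if x = a then 1 else 0) = M (a, a)"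
  using assms unfolding quad_form_def
  by (simp add: if_distrib[of "\<lambda>u. u * _"] if_distrib[of "\<lambda>u. _ * u"] cong: if_cong)

lemma is_loc_matrix_iff:
  "is_loc_matrix q k z M \<longleftrightarrow>
     M = restrict (\<lambda>(\<alpha>, \<beta>). riesz z (q * monomial (\<alpha> + \<beta>))) (loc_index q k \<times> loc_index q k)"
proof -
  let ?I = "loc_index q k"
  define N where "N = restrict (\<lambda>(\<alpha>, \<beta>). riesz z (q * monomial (\<alpha> + \<beta>))) (?I \<times> ?I)"
  have N_vec: "N \<in> real_vecs (?I \<times> ?I)" by (simp add: N_def)
  have N_sym: "symmetric_on ?I N" by (auto simp: N_def symmetric_on_def add.commute)
  have N_form: "riesz z (q * p ^ 2) = quad_form ?I N (Poly_Mapping.lookup p)"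
    if "pdeg (q * p ^ 2) \<le> 2 * k" for p
  proof (cases "q = 0")
    case True
    then show ?thesis by (simp add: quad_form_def N_def riesz_zero)
  next
    case False
    have "quad_form ?I N v = quad_form ?I (\<lambda>(\<alpha>, \<beta>). riesz z (q * monomial (\<alpha> + \<beta>))) v" for v
      by (simp add: quad_form_def N_def)
    then show ?thesis
      using riesz_square[OF finite_loc_index keys_subset_loc_index[OF False that]] by simp
  qed
  have N: "is_loc_matrix q k z N"
    using N_vec N_sym N_form by (simp add: is_loc_matrix_def)
  have "M = N" if M: "is_loc_matrix q k z M"
  proof (rule ext)
    have M_sym: "symmetric_on ?I M" using M by (simp add: is_loc_matrix_def)
    have same: "quad_form ?I M (Poly_Mapping.lookup p) = quad_form ?I N (Poly_Mapping.lookup p)"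
      if "Poly_Mapping.keys p \<subseteq> ?I" "?I \<noteq> {}" for p
      using M N pdeg_le_of_loc_index[OF that] by (simp add: is_loc_matrix_def)
    have diag: "M (a, a) = N (a, a)" if "a \<in> ?I" for a
    proof -
      have "Poly_Mapping.lookup (monomial a) = (\<lambda>x. if x = a then 1 else 0)"
        by (auto simp: monomial_def lookup_single when_def)
      moreover have "Poly_Mapping.keys (monomial a) \<subseteq> ?I" using that by (simp add: monomial_def)
      ultimately show ?thesis
        using same[of "monomial a"] that quad_form_one[OF finite_loc_index that] by auto
    qed
    have off: "M (a, b) = N (a, b)" if "a \<in> ?I" "b \<in> ?I" "a \<noteq> b" for a b
    proof -
      let ?p = "monomial a + monomial b"
      have "Poly_Mapping.lookup ?p = (\<lambda>x. if x = a \<or> x = b then 1 else 0)"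
        using that(3) by (auto simp: monomial_def lookup_add lookup_single when_def)
      moreover have "Poly_Mapping.keys ?p \<subseteq> ?I"
        using that(1,2) keys_add[of "monomial a" "monomial b"] by (auto simp: monomial_def)
      ultimately have "M (a, a) + 2 * M (a, b) + M (b, b) = N (a, a) + 2 * N (a, b) + N (b, b)"
        using same[of ?p] that(1) quad_form_two[OF finite_loc_index that M_sym]
          quad_form_two[OF finite_loc_index that N_sym] by auto
      then show ?thesis using diag that(1,2) by simp
    qed
    fix ab
    show "M ab = N ab"
    proof (cases "ab \<in> ?I \<times> ?I")
      case True
      then show ?thesis using diag off by (cases "fst ab = snd ab") auto
    next
      case False
      moreover have "M \<in> real_vecs (?I \<times> ?I)" using M by (simp add: is_loc_matrix_def)
      ultimately show ?thesis using N_vec by (metis PiE_arb)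
    qed
  qed
  then show ?thesis using N N_def by auto
qed

lemma loc_matrix_entry:
  assumes "\<alpha> \<in> loc_index q k" "\<beta> \<in> loc_index q k"
  shows "loc_matrix q k z (\<alpha>, \<beta>) = riesz z (q * monomial (\<alpha> + \<beta>))"
  using assms by (simp add: loc_matrix_def is_loc_matrix_iff)

end

theory Submission
  imports Defs
begin

text \<open>
  The section of the moment cone contains the convex hull of the points
  \<open>(x\<^sup>\<alpha> / f x)\<close>, \<open>\<alpha> \<in> A\<close>, \<open>x \<in> K\<close>, which are moment vectors of atomic measures.  A linear inequality
  \<open>\<langle>p, y\<rangle> \<le> c\<close> that is strict on these points says that \<open>c f - p > 0\<close> on \<open>K\<close>, so by Putinar's
  Positivstellensatz \<open>c f - p\<close> lies in \<open>I(h) + Q(g)\<close>, and the inequality is valid on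
  \<open>S_section h g A k f\<close> for all large \<open>k\<close>.  Applied to \<open>p = \<plusminus>x\<^sup>\<alpha>\<close> this bounds the relaxations; a limit
  point at positive distance from the hull could be separated from it, a contradiction.

  The Positivstellensatz: with \<open>b = R - \<parallel>x\<parallel>\<^sup>2\<close> the quadratic module of the single weight \<open>b\<close> is a
  semiring containing \<open>a \<plusminus> x\<^sub>i\<close> for \<open>a = (1 + R) / 2\<close>, hence every polynomial whose
  coefficients in a tensor product Bernstein basis on \<open>[-a, a]\<^sup>n\<close> are nonnegative; for a polynomial positive
  on the box this holds in high degree.  A polynomial positive only on \<open>K\<close> is made positive on the box
  by subtracting an element of \<open>I(h) + Q(g)\<close>.
\<close>

subsection \<open>Polynomials and quadratic modules\<close>

lemma pconst_hom:
  "pconst 0 = 0" "pconst 1 = 1" "pconst (a + b) = pconst a + pconst b"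
  "pconst (a * b) = pconst a * pconst b" "pconst (- a) = - pconst a"
  "pconst (a - b) = pconst a - pconst b" "pconst (a ^ k) = pconst a ^ k"
proof -
  show 1: "pconst 0 = 0" "pconst 1 = 1" and add: "pconst (a + b) = pconst a + pconst b" for a b
    by (simp_all add: pconst_def single_add)
  show mult: "pconst (a * b) = pconst a * pconst b" for a b
    by (simp add: pconst_def mult_single)
  show "pconst (- a) = - pconst a" "pconst (a - b) = pconst a - pconst b"
    by (simp_all add: pconst_def single_uminus single_diff)
  show "pconst (a ^ k) = pconst a ^ k"
    by (induction k) (simp_all add: 1 mult)
qed

lemma pconst_sum: "pconst (\<Sum>i\<in>I. c i) = (\<Sum>i\<in>I. pconst (c i))"
  by (induction I rule: infinite_finite_induct) (simp_all add: pconst_hom)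

lemma pconst_prod: "pconst (\<Prod>i\<in>I. c i) = (\<Prod>i\<in>I. pconst (c i))"
  by (induction I rule: infinite_finite_induct) (simp_all add: pconst_hom)

lemma pconst_of_nat: "pconst (of_nat k) = of_nat k"
  by (induction k) (simp_all add: pconst_hom)

lemma monomial_zero: "monomial 0 = 1"
  by (simp add: monomial_def)

lemma monomial_sum: "monomial (\<Sum>i\<in>I. \<alpha> i) = (\<Prod>i\<in>I. monomial (\<alpha> i))"
  by (induction I rule: infinite_finite_induct) (simp_all add: monomial_zero monomial_mult[symmetric])

lemma pvar_power: "pvar (i :: 'n::finite) ^ k = monomial (axis i k)"
proof (induction k)
  case 0
  have "axis i 0 = (0 :: 'n expo)" by (simp add: axis_def vec_eq_iff)
  then show ?case by (simp only: power_0 monomial_zero)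
next
  case (Suc k)
  have "axis i 1 + axis i k = (axis i (Suc k) :: 'n expo)"
    by (simp add: axis_def vec_eq_iff)
  then show ?case using Suc by (simp add: pvar_def monomial_mult)
qed

lemma monomial_eq_prod_pvar: "monomial \<alpha> = (\<Prod>i\<in>UNIV. pvar i ^ (\<alpha> $ i))"
proof -
  have "(\<Sum>i\<in>UNIV. axis i (\<alpha> $ i)) = \<alpha>"
    by (simp add: vec_eq_iff axis_def)
  then show ?thesis by (simp add: pvar_power monomial_sum[symmetric])
qed

section \<open>Evaluation at a point as a ring homomorphism\<close>

text \<open>Evaluation is the Riesz functional of the moments of a unit point mass, so its linearity
  is inherited from \<open>riesz\<close>.\<close>

lemma peval_eq_riesz: "peval p x = riesz (\<lambda>\<alpha>. monomial_eval \<alpha> x) p"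
  by (simp add: peval_def riesz_def)

lemma monomial_eval_add: "monomial_eval (\<alpha> + \<beta>) x = monomial_eval \<alpha> x * monomial_eval \<beta> x"
  by (simp add: monomial_eval_def power_add prod.distrib)

lemma riesz_monomial: "riesz z (monomial \<alpha>) = z \<alpha>"
  by (simp add: riesz_def monomial_def)

lemma peval_add: "peval (p + q) x = peval p x + peval q x"
  by (simp add: peval_eq_riesz riesz_add)

lemma peval_sum: "peval (\<Sum>i\<in>I. p i) x = (\<Sum>i\<in>I. peval (p i) x)"
  by (simp add: peval_eq_riesz riesz_sum)

lemma peval_pconst_mult: "peval (pconst c * p) x = c * peval p x"
  by (simp add: peval_eq_riesz riesz_pconst_mult)

lemma peval_monomial: "peval (monomial \<alpha>) x = monomial_eval \<alpha> x"
  by (simp add: peval_eq_riesz riesz_monomial)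

lemma peval_one: "peval 1 x = 1"
  using peval_monomial[of 0 x] by (simp add: monomial_zero monomial_eval_def)

lemma peval_pconst: "peval (pconst c) x = c"
  using peval_pconst_mult[of c 1 x] by (simp add: peval_one)

lemma peval_uminus: "peval (- p) x = - peval p x"
  using peval_pconst_mult[of "-1" p x] by (simp add: pconst_hom)

lemma peval_diff: "peval (p - q) x = peval p x - peval q x"
  using peval_add[of p "- q" x] by (simp add: peval_uminus)

lemma peval_mult: "peval (p * q) x = peval p x * peval q x"
proof -
  let ?P = "Poly_Mapping.keys p" and ?Q = "Poly_Mapping.keys q"
  have "p * q = (\<Sum>\<alpha>\<in>?P. pconst (Poly_Mapping.lookup p \<alpha>) * monomial \<alpha>) *
      (\<Sum>\<beta>\<in>?Q. pconst (Poly_Mapping.lookup q \<beta>) * monomial \<beta>)"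
    using poly_expand[of ?P p] poly_expand[of ?Q q] by simp
  also have "\<dots> = (\<Sum>\<alpha>\<in>?P. \<Sum>\<beta>\<in>?Q. pconst (Poly_Mapping.lookup p \<alpha>) *
      (pconst (Poly_Mapping.lookup q \<beta>) * monomial (\<alpha> + \<beta>)))"
    by (simp add: sum_product monomial_mult[symmetric] mult_ac)
  finally show ?thesis
    by (simp only: peval_sum peval_pconst_mult peval_monomial monomial_eval_add)
      (simp add: peval_def sum_product mult_ac)
qed

lemma peval_power: "peval (p ^ k) x = peval p x ^ k"
  by (induction k) (simp_all add: peval_one peval_mult)

lemma peval_pvar: "peval (pvar i) x = x $ i"
proof -
  have "monomial_eval (axis i 1) x = (\<Prod>j\<in>UNIV. if j = i then x $ j else 1)"
    unfolding monomial_eval_def by (intro prod.cong) (auto simp: axis_def)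
  then show ?thesis by (simp add: pvar_def peval_monomial)
qed

lemmas peval_simps = peval_add peval_sum peval_one peval_pconst peval_uminus peval_diff
  peval_mult peval_power peval_pvar

section \<open>The quadratic module of the constraints\<close>

text \<open>This is \<open>I(h) + Q(g)\<close>, presented by generators closed under addition.
  Nonnegativity on the feasible set and under the truncated functionals then follows by rule
  induction.\<close>

inductive_set qmodule :: "'n::finite rpoly list \<Rightarrow> 'n rpoly list \<Rightarrow> 'n rpoly set"
  for h g where
  square: "q ^ 2 \<in> qmodule h g"
| weight: "p \<in> set g \<Longrightarrow> p * q ^ 2 \<in> qmodule h g"
| ideal: "p \<in> set h \<Longrightarrow> p * q \<in> qmodule h g"
| add: "p \<in> qmodule h g \<Longrightarrow> q \<in> qmodule h g \<Longrightarrow> p + q \<in> qmodule h g"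

lemma qmodule_zero: "0 \<in> qmodule h g"
  using qmodule.square[of 0] by simp

lemma qmodule_sum: "(\<And>i. i \<in> I \<Longrightarrow> p i \<in> qmodule h g) \<Longrightarrow> (\<Sum>i\<in>I. p i) \<in> qmodule h g"
  by (induction I rule: infinite_finite_induct) (simp_all add: qmodule_zero qmodule.add)

lemma qmodule_mult_square: "p \<in> qmodule h g \<Longrightarrow> p * r ^ 2 \<in> qmodule h g"
proof (induction rule: qmodule.induct)
  case (square q)
  then show ?case using qmodule.square[of "q * r"] by (simp add: power_mult_distrib)
next
  case (weight p q)
  then show ?case using qmodule.weight[of p g "q * r"] by (simp add: power_mult_distrib mult.assoc)
next
  case (ideal p q)
  then show ?case using qmodule.ideal[of p h "q * r\<^sup>2"] by (simp add: mult.assoc)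
next
  case (add p q)
  then show ?case by (simp add: distrib_right qmodule.add)
qed

lemma qmodule_pconst_mult:
  assumes "p \<in> qmodule h g" "c \<ge> 0"
  shows "pconst c * p \<in> qmodule h g"
  using qmodule_mult_square[OF assms(1), of "pconst (sqrt c)"] assms(2)
  by (simp add: pconst_hom[symmetric] mult.commute)

lemma qmodule_pconst: "c \<ge> 0 \<Longrightarrow> pconst c \<in> qmodule h g"
  using qmodule_pconst_mult[of 1 h g c] qmodule.square[of 1 h g] by simp

text \<open>Multiples of \<open>b\<close> by squares stay in \<open>qmodule h g\<close>, so a
  certificate with the ball polynomial as its only weight transfers to the given
  constraints.\<close>

lemma qmodule_mono:
  assumes "p \<in> qmodule [] [b]" "b \<in> qmodule h g"
  shows "p \<in> qmodule h g"
  using assms(1)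
  by induction (auto intro: qmodule.square qmodule.add qmodule_mult_square[OF assms(2)])

text \<open>Only with a single weight \<open>b\<close>: then \<open>b * b\<close> is a square.\<close>

lemma qmodule_single_mult:
  assumes "p \<in> qmodule [] [b]" "q \<in> qmodule [] [b]"
  shows "p * q \<in> qmodule [] [b]"
  using assms(1)
proof induction
  case (square r)
  then show ?case using qmodule_mult_square[OF assms(2), of r] by (simp add: mult.commute)
next
  case (weight p r)
  then have p: "p = b" by simp
  have "b * q \<in> qmodule [] [b]"
    using assms(2)
  proof induction
    case (square s)
    then show ?case by (simp add: qmodule.weight)
  next
    case (weight p s)
    then show ?case
      using qmodule.square[of "b * s" "[]" "[b]"] by (simp add: power2_eq_square mult_ac)
  next
    case (ideal p s)
    then show ?case by simp
  next
    case (add p q)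
    then show ?case by (simp add: distrib_left qmodule.add)
  qed
  then show ?case using qmodule_mult_square[of "b * q" "[]" "[b]" r] p by (simp add: mult_ac)
next
  case (ideal p r)
  then show ?case by simp
next
  case (add p r)
  then show ?case by (simp add: distrib_right qmodule.add)
qed

lemma qmodule_single_prod:
  "(\<And>i. i \<in> I \<Longrightarrow> p i \<in> qmodule [] [b]) \<Longrightarrow> (\<Prod>i\<in>I. p i) \<in> qmodule [] [b]"
  using qmodule.square[of 1 "[]" "[b]"]
  by (induction I rule: infinite_finite_induct) (simp_all add: qmodule_single_mult)

lemma qmodule_single_power: "p \<in> qmodule [] [b] \<Longrightarrow> p ^ k \<in> qmodule [] [b]"
  using qmodule_single_prod[of "{..<k}" "\<lambda>_. p" b] by simp

lemma sos_mult_qmodule: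
  assumes "sos s" "p \<in> qmodule h g"
  shows "s * p \<in> qmodule h g"
proof -
  from assms(1) obtain qs where "s = (\<Sum>q\<leftarrow>qs. q ^ 2)" by (auto simp: sos_def)
  moreover have "p * (\<Sum>q\<leftarrow>qs. q ^ 2) \<in> qmodule h g"
    by (induction qs)
      (simp_all add: qmodule_zero distrib_left qmodule.add qmodule_mult_square[OF assms(2)])
  ultimately show ?thesis by (simp add: mult.commute)
qed

lemma ideal_plus_quad_module_subset:
  assumes "a \<in> poly_ideal h" "b \<in> quad_module g"
  shows "a + b \<in> qmodule h g"
proof (rule qmodule.add)
  show "a \<in> qmodule h g"
    using assms(1) by (auto simp: poly_ideal_def intro!: qmodule_sum qmodule.ideal)
  obtain s0 s where b: "b = s0 + (\<Sum>j<length g. s j * g ! j)" "sos s0" "\<And>j. j < length g \<Longrightarrow> sos (s j)"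
    using assms(2) by (auto simp: quad_module_def)
  have "s0 \<in> qmodule h g"
    using sos_mult_qmodule[OF b(2) qmodule.square[of 1 h g]] by simp
  moreover have "s j * g ! j \<in> qmodule h g" if "j < length g" for j
    using sos_mult_qmodule[OF b(3)[OF that] qmodule.weight[of "g ! j" g 1 h]] that by simp
  ultimately show "b \<in> qmodule h g"
    unfolding b(1) by (intro qmodule.add qmodule_sum) auto
qed

text \<open>Every generator is nonnegative on the feasible set. This easy converse of the
  Positivstellensatz, applied to the ball polynomial, bounds that set.\<close>

lemma peval_qmodule_nonneg:
  assumes "p \<in> qmodule h g" "x \<in> semialg h g"
  shows "peval p x \<ge> 0"
  using assms(1)
  by induction (use assms(2) in \<open>auto simp: peval_simps semialg_def\<close>)

text \<open>For \<open>s = pvar i\<close> and \<open>s = - pvar i\<close>, twice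
  \<open>(1 + R) / 2 + s\<close> equals \<open>(s + 1) ^ 2 + b\<close> plus the squares of the other
  variables.\<close>

lemma pvar_bounds_in_ball_qmodule:
  fixes b :: "'n::finite rpoly"
  assumes "R > 0" and b: "b = pconst R - (\<Sum>i\<in>UNIV. pvar i ^ 2)"
  shows "pconst ((1 + R) / 2) + pvar i \<in> qmodule [] [b]"
    and "pconst ((1 + R) / 2) - pvar i \<in> qmodule [] [b]"
proof -
  have half: "pconst (1/2) * (1 + pconst R + pconst 2 * s) = pconst ((1 + R) / 2) + s" for s :: "'n rpoly"
  proof -
    have "pconst (1/2) * pconst 2 = (1 :: 'n rpoly)"
      by (simp add: pconst_hom(4)[symmetric] pconst_hom(2))
    moreover have "pconst (1/2) * (1 + pconst R) = (pconst ((1 + R) / 2) :: 'n rpoly)"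
      unfolding pconst_hom(2)[symmetric] pconst_hom(3,4)[symmetric] by simp
    ultimately show ?thesis
      by (simp add: distrib_left mult.assoc[symmetric])
  qed
  have eq: "(s + 1) ^ 2 + (b + (\<Sum>j\<in>UNIV - {i}. pvar j ^ 2)) = 1 + pconst R + pconst 2 * s"
    if "s ^ 2 = pvar i ^ 2" for s
  proof -
    have "b + (\<Sum>j\<in>UNIV - {i}. pvar j ^ 2) = pconst R - s ^ 2"
      unfolding b that by (subst sum.remove[of UNIV i]) auto
    moreover have "pconst 2 = (2 :: 'n rpoly)" using pconst_of_nat[of 2] by simp
    ultimately show ?thesis by (simp add: power2_sum)
  qed
  have mem: "(s + 1) ^ 2 + (b + (\<Sum>j\<in>UNIV - {i}. pvar j ^ 2)) \<in> qmodule [] [b]" for s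
    using qmodule.weight[of b "[b]" 1] by (intro qmodule.add qmodule_sum qmodule.square) auto
  have *: "pconst ((1 + R) / 2) + s \<in> qmodule [] [b]" if "s ^ 2 = pvar i ^ 2" for s
    using qmodule_pconst_mult[OF mem[of s], of "1/2"] unfolding eq[OF that] half by simp
  show "pconst ((1 + R) / 2) + pvar i \<in> qmodule [] [b]" by (rule *) simp
  show "pconst ((1 + R) / 2) - pvar i \<in> qmodule [] [b]" using *[of "- pvar i"] by simp
qed

subsection \<open>Polynomials positive on a box\<close>

text \<open>The bound on the reference sequence \<open>g\<close> makes the relation compatible with
  products, hence with polynomial expressions.\<close>

definition asymp_eq :: "(nat \<Rightarrow> real) \<Rightarrow> (nat \<Rightarrow> real) \<Rightarrow> bool" where
  "asymp_eq f g \<longleftrightarrow> (\<lambda>m. f m - g m) \<longlonglongrightarrow> 0 \<and> (\<exists>K. \<forall>m. \<bar>g m\<bar> \<le> K)"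

lemma asymp_eq_const: "asymp_eq (\<lambda>_. c) (\<lambda>_. c)"
  by (auto simp: asymp_eq_def)

lemma asymp_eq_add:
  assumes "asymp_eq f g" "asymp_eq f' g'"
  shows "asymp_eq (\<lambda>m. f m + f' m) (\<lambda>m. g m + g' m)"
proof -
  have "(\<lambda>m. (f m - g m) + (f' m - g' m)) \<longlonglongrightarrow> 0"
    using tendsto_add[of "\<lambda>m. f m - g m" 0 sequentially "\<lambda>m. f' m - g' m" 0] assms by (simp add: asymp_eq_def)
  moreover obtain K K' where "\<And>m. \<bar>g m\<bar> \<le> K" "\<And>m. \<bar>g' m\<bar> \<le> K'"
    using assms by (auto simp: asymp_eq_def)
  then have "\<bar>g m + g' m\<bar> \<le> K + K'" for m
    using abs_triangle_ineq[of "g m" "g' m"] by (smt (verit))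
  then have "\<exists>K. \<forall>m. \<bar>g m + g' m\<bar> \<le> K" by blast
  ultimately show ?thesis by (simp add: asymp_eq_def algebra_simps)
qed

lemma asymp_eq_mult:
  assumes "asymp_eq f g" "asymp_eq f' g'"
  shows "asymp_eq (\<lambda>m. f m * f' m) (\<lambda>m. g m * g' m)"
proof -
  have lim: "(\<lambda>m. f m - g m) \<longlonglongrightarrow> 0" "(\<lambda>m. f' m - g' m) \<longlonglongrightarrow> 0"
    using assms by (auto simp: asymp_eq_def)
  obtain K K' where K: "\<And>m. \<bar>g m\<bar> \<le> K" "\<And>m. \<bar>g' m\<bar> \<le> K'"
    using assms by (auto simp: asymp_eq_def)
  then have bnd: "Bseq g" "Bseq g'"
    using BseqI'[of g K] BseqI'[of g' K'] by auto
  have Z: "Zfun (\<lambda>m. f m - g m) sequentially" "Zfun (\<lambda>m. f' m - g' m) sequentially"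
    using lim tendsto_Zfun_iff[of _ 0] by auto
  \<comment> \<open>This sum equals \<open>f m * f' m - g m * g' m\<close>; each summand is a null
    sequence times a null or bounded one.\<close>
  have "Zfun (\<lambda>m. (f m - g m) * (f' m - g' m) + (f m - g m) * g' m + g m * (f' m - g' m)) sequentially"
    by (intro Zfun_add bounded_bilinear.Zfun[OF bounded_bilinear_mult]
        bounded_bilinear.Zfun_prod_Bfun[OF bounded_bilinear_mult]
        bounded_bilinear.Bfun_prod_Zfun[OF bounded_bilinear_mult] Z bnd)
  then have "(\<lambda>m. f m * f' m - g m * g' m) \<longlonglongrightarrow> 0"
    using tendsto_Zfun_iff[of "\<lambda>m. f m * f' m - g m * g' m" 0] by (simp add: algebra_simps)
  moreover have "\<bar>g m * g' m\<bar> \<le> K * K'" for m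
    using mult_mono[OF K(1)[of m] K(2)[of m]] K(1)[of m] by (simp add: abs_mult)
  ultimately show ?thesis by (auto simp: asymp_eq_def)
qed

lemma asymp_eq_sum:
  "(\<And>i. i \<in> I \<Longrightarrow> asymp_eq (f i) (g i)) \<Longrightarrow> asymp_eq (\<lambda>m. \<Sum>i\<in>I. f i m) (\<lambda>m. \<Sum>i\<in>I. g i m)"
  by (induction I rule: infinite_finite_induct) (simp_all add: asymp_eq_const asymp_eq_add)

lemma asymp_eq_prod:
  "(\<And>i. i \<in> I \<Longrightarrow> asymp_eq (f i) (g i)) \<Longrightarrow> asymp_eq (\<lambda>m. \<Prod>i\<in>I. f i m) (\<lambda>m. \<Prod>i\<in>I. g i m)"
  by (induction I rule: infinite_finite_induct) (simp_all add: asymp_eq_const asymp_eq_mult)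

section \<open>Bernstein expansions and their coefficients\<close>

lemma binomial_eq_prod: "real (k choose s) = (\<Prod>j<s. real k - real j) / fact s"
  by (simp add: binomial_gbinomial gbinomial_prod_rev atLeast0LessThan)

text \<open>Both binomials split into \<open>s\<close> linear factors, and each quotient of factors
  approaches \<open>i m / m\<close>. As \<open>i\<close> is an arbitrary sequence, this amounts to
  uniformity over all grid indices.\<close>

lemma asymp_eq_binomial_ratio:
  assumes "\<And>m. i m \<le> m"
  shows "asymp_eq (\<lambda>m. real (i m choose s) / real (m choose s)) (\<lambda>m. (real (i m) / real m) ^ s)"
proof -
  have fac: "asymp_eq (\<lambda>m. (real (i m) - real j) / (real m - real j)) (\<lambda>m. real (i m) / real m)" for j
  proof -
    have "\<forall>\<^sub>F m in sequentially. norm ((real (i m) - real j) / (real m - real j) - real (i m) / real m) \<le>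
        real j / (real m - real j)"
      using eventually_gt_at_top[of j]
    proof eventually_elim
      case (elim m)
      have im: "real (i m) \<le> real m" using assms by simp
      \<comment> \<open>The difference is \<open>- c * t\<close> with \<open>c\<close> tending to 0
        and \<open>t\<close> in the unit interval.\<close>
      define c t where "c = real j / (real m - real j)" and "t = (real m - real (i m)) / real m"
      have "(real (i m) - real j) / (real m - real j) - real (i m) / real m = - c * t"
        using elim by (simp add: c_def t_def field_simps)
      moreover have "0 \<le> t" "t \<le> 1"
        using im elim by (simp_all add: t_def field_simps)
      moreover have "0 \<le> c" using elim by (simp add: c_def)
      ultimately show ?case
        unfolding c_def[symmetric] by (simp add: abs_mult mult_left_le)
    qed
    moreover have "(\<lambda>m. real j / (real m - real j)) \<longlonglongrightarrow> 0"
      by (rule LIMSEQ_offset[of _ j]) (simp add: lim_const_over_n)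
    ultimately have "(\<lambda>m. (real (i m) - real j) / (real m - real j) - real (i m) / real m) \<longlonglongrightarrow> 0"
      by (rule Lim_null_comparison)
    \<comment> \<open>At \<open>m = 0\<close> the quotient is 0 by convention.\<close>
    moreover have "\<bar>real (i m) / real m\<bar> \<le> 1" for m
      using assms[of m] by (auto simp: divide_le_eq)
    ultimately show ?thesis
      unfolding asymp_eq_def by blast
  qed
  have "asymp_eq (\<lambda>m. \<Prod>j<s. (real (i m) - real j) / (real m - real j)) (\<lambda>m. \<Prod>j<s. real (i m) / real m)"
    by (intro asymp_eq_prod fac)
  then show ?thesis
    by (simp add: binomial_eq_prod prod_dividef)
qed

text \<open>The form in two ring elements lets \<open>u\<close> and \<open>v\<close> be the
  polynomials \<open>(a + x) / (2 * a)\<close> and \<open>(a - x) / (2 * a)\<close>, which sum to 1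
  and lie in the quadratic module.\<close>

definition bernstein :: "nat \<Rightarrow> nat \<Rightarrow> 'a::comm_ring_1 \<Rightarrow> 'a \<Rightarrow> 'a" where
  "bernstein m i u v = of_nat (m choose i) * u ^ i * v ^ (m - i)"

text \<open>Degree elevation: multiply by \<open>(u + v) ^ (m - s) = 1\<close>, expand, and use
  \<open>(m choose i) * (i choose s) = (m choose s) * ((m - s) choose (i - s))\<close>.\<close>

lemma power_eq_sum_bernstein:
  fixes u v :: "'n::finite rpoly"
  assumes "u + v = 1" "s \<le> m"
  shows "u ^ s = (\<Sum>i\<le>m. pconst (real (i choose s) / real (m choose s)) * bernstein m i u v)"
proof -
  have "u ^ s = u ^ s * (u + v) ^ (m - s)" using assms by simp
  also have "\<dots> = (\<Sum>k\<le>m - s. of_nat ((m - s) choose k) * u ^ (k + s) * v ^ (m - s - k))"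
    by (simp add: binomial_ring sum_distrib_left power_add mult_ac)
  also have "\<dots> = (\<Sum>i\<in>{s..m}. of_nat ((m - s) choose (i - s)) * u ^ i * v ^ (m - i))"
    using assms(2) by (intro sum.reindex_bij_witness[of _ "\<lambda>i. i - s" "\<lambda>k. k + s"])
      (auto simp: add.commute)
  also have "\<dots> = (\<Sum>i\<in>{s..m}. pconst (real (i choose s) / real (m choose s)) * bernstein m i u v)"
  proof (intro sum.cong refl)
    fix i assume i: "i \<in> {s..m}"
    have "real (m choose i) * real (i choose s) = real (m choose s) * real ((m - s) choose (i - s))"
      using choose_mult[of s i m] i by (metis atLeastAtMost_iff of_nat_mult)
    moreover have "real (m choose s) \<noteq> 0" using assms(2) by simp
    ultimately have "real ((m - s) choose (i - s)) = real (i choose s) / real (m choose s) * real (m choose i)"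
      by (simp add: field_simps)
    then have "(of_nat ((m - s) choose (i - s)) :: 'n rpoly) =
        pconst (real (i choose s) / real (m choose s)) * of_nat (m choose i)"
      by (metis pconst_of_nat pconst_hom(4))
    then show "of_nat ((m - s) choose (i - s)) * u ^ i * v ^ (m - i) =
        pconst (real (i choose s) / real (m choose s)) * bernstein m i u v"
      by (simp add: bernstein_def mult.assoc)
  qed
  \<comment> \<open>The added terms with \<open>i < s\<close> vanish because
    \<open>i choose s = 0\<close>.\<close>
  also have "\<dots> = (\<Sum>i\<le>m. pconst (real (i choose s) / real (m choose s)) * bernstein m i u v)"
    by (rule sum.mono_neutral_left) (auto simp: pconst_hom not_le binomial_eq_0)
  finally show ?thesis .
qed

text \<open>The coefficients of \<open>x\<^sup>j\<close> in the Bernstein basis of degree \<open>m\<close> on \<open>[-a, a]\<close>.\<close>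

definition bernstein_coeff :: "real \<Rightarrow> nat \<Rightarrow> nat \<Rightarrow> nat \<Rightarrow> real" where
  "bernstein_coeff a m j i = (\<Sum>s\<le>j. real (j choose s) * (2 * a) ^ s * (- a) ^ (j - s) *
     (real (i choose s) / real (m choose s)))"

lemma affine_power_eq_sum_bernstein:
  fixes u v :: "'n::finite rpoly"
  assumes "u + v = 1" "j \<le> m"
  shows "(pconst (2 * a) * u - pconst a) ^ j =
    (\<Sum>i\<le>m. pconst (bernstein_coeff a m j i) * bernstein m i u v)"
proof -
  have "(pconst (2 * a) * u - pconst a) ^ j = (pconst (2 * a) * u + pconst (- a)) ^ j"
    by (simp add: pconst_hom)
  also have "\<dots> = (\<Sum>s\<le>j. pconst (real (j choose s) * (2 * a) ^ s * (- a) ^ (j - s)) * u ^ s)"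
    unfolding binomial_ring
    by (intro sum.cong refl) (simp only: pconst_hom(4,7) pconst_of_nat power_mult_distrib mult_ac)
  also have "\<dots> = (\<Sum>s\<le>j. \<Sum>i\<le>m. pconst (real (j choose s) * (2 * a) ^ s * (- a) ^ (j - s) *
      (real (i choose s) / real (m choose s))) * bernstein m i u v)"
    using power_eq_sum_bernstein[OF assms(1), of _ m] assms(2)
    by (intro sum.cong refl) (simp only: atMost_iff pconst_hom(4) sum_distrib_left mult_ac)
  also have "\<dots> = (\<Sum>i\<le>m. \<Sum>s\<le>j. pconst (real (j choose s) * (2 * a) ^ s * (- a) ^ (j - s) *
      (real (i choose s) / real (m choose s))) * bernstein m i u v)"
    by (rule sum.swap)
  finally show ?thesis
    by (simp only: bernstein_coeff_def pconst_sum sum_distrib_right)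
qed

text \<open>Replacing each binomial ratio by a power of \<open>i m / m\<close> leaves the binomial
  expansion of \<open>x ^ j\<close> at the grid point \<open>x = 2 * a * (i m / m) - a\<close>:
  Bernstein coefficients approximate values.\<close>

lemma asymp_eq_bernstein_coeff:
  assumes "\<And>m. i m \<le> m"
  shows "asymp_eq (\<lambda>m. bernstein_coeff a m j (i m)) (\<lambda>m. (2 * a * (real (i m) / real m) - a) ^ j)"
proof -
  have "(2 * a * t - a) ^ j = (\<Sum>s\<le>j. real (j choose s) * (2 * a) ^ s * (- a) ^ (j - s) * t ^ s)" for t
    using binomial_ring[of "2 * a * t" "- a" j] by (simp add: power_mult_distrib mult_ac)
  then show ?thesis
    unfolding bernstein_coeff_def
    by (simp only:) (intro asymp_eq_sum asymp_eq_mult asymp_eq_const asymp_eq_binomial_ratio assms)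
qed

text \<open>In high degree the Bernstein coefficients of \<open>p\<close> are close to its values on
  a grid in the box, hence nonnegative. The basis polynomials are products of elements of the
  single-weight module, which is closed under products.\<close>

lemma positive_on_box_in_qmodule:
  fixes p b :: "'n::finite rpoly"
  assumes "a > 0"
    and lin: "\<And>i. pconst a + pvar i \<in> qmodule [] [b]" "\<And>i. pconst a - pvar i \<in> qmodule [] [b]"
    and pos: "\<And>x. (\<And>i. \<bar>x $ i\<bar> \<le> a) \<Longrightarrow> peval p x > 0"
  shows "p \<in> qmodule [] [b]"
proof -
  \<comment> \<open>Barycentric coordinates of the interval from \<open>- a\<close> to
    \<open>a\<close> in each variable.\<close>
  define u v :: "'n \<Rightarrow> 'n rpoly" where
    "u l = pconst (1 / (2 * a)) * (pconst a + pvar l)" and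
    "v l = pconst (1 / (2 * a)) * (pconst a - pvar l)" for l
  have uv: "u l + v l = 1" for l
  proof -
    have "u l + v l = pconst (1 / (2 * a)) * (pconst a + pconst a)"
      by (simp add: u_def v_def algebra_simps)
    then show ?thesis
      using assms(1) unfolding pconst_hom(3,4)[symmetric] by (simp add: pconst_hom)
  qed
  have pvar_eq: "pvar l = pconst (2 * a) * u l - pconst a" for l
  proof -
    have "pconst (2 * a) * pconst (1 / (2 * a)) = (1 :: 'n rpoly)"
      using assms(1) unfolding pconst_hom(4)[symmetric] by (simp add: pconst_hom)
    then show ?thesis by (simp add: u_def mult.assoc[symmetric])
  qed
  have bern_in: "bernstein m i (u l) (v l) \<in> qmodule [] [b]" for m i l
    unfolding bernstein_def pconst_of_nat[symmetric] u_def v_def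
    using assms(1)
    by (intro qmodule_single_mult qmodule_single_power qmodule_pconst lin) auto
  define coeff where "coeff m \<iota> = (\<Sum>\<alpha>\<in>Poly_Mapping.keys p. Poly_Mapping.lookup p \<alpha> *
      (\<Prod>l\<in>UNIV. bernstein_coeff a m (\<alpha> $ l) (\<iota> l)))" for m and \<iota> :: "'n \<Rightarrow> nat"
  have expand: "p = (\<Sum>\<iota>\<in>(UNIV :: 'n set) \<rightarrow>\<^sub>E {..m}.
      pconst (coeff m \<iota>) * (\<Prod>l\<in>UNIV. bernstein m (\<iota> l) (u l) (v l)))" if m: "pdeg p \<le> m" for m
  proof -
    let ?J = "(UNIV :: 'n set) \<rightarrow>\<^sub>E {..m}"
    have mono: "monomial \<alpha> = (\<Sum>\<iota>\<in>?J. pconst (\<Prod>l\<in>UNIV. bernstein_coeff a m (\<alpha> $ l) (\<iota> l)) *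
        (\<Prod>l\<in>UNIV. bernstein m (\<iota> l) (u l) (v l)))" if "\<alpha> \<in> Poly_Mapping.keys p" for \<alpha>
    proof -
      have "\<alpha> $ l \<le> m" for l
        using member_le_sum[of l UNIV "\<lambda>i. \<alpha> $ i"] expo_deg_le_pdeg[OF that] m
        by (simp add: expo_deg_def)
      then have "monomial \<alpha> = (\<Prod>l\<in>UNIV. \<Sum>i\<le>m. pconst (bernstein_coeff a m (\<alpha> $ l) i) *
          bernstein m i (u l) (v l))"
        unfolding monomial_eq_prod_pvar
        by (intro prod.cong refl) (simp only: pvar_eq affine_power_eq_sum_bernstein[OF uv])
      also have "\<dots> = (\<Sum>\<iota>\<in>?J. \<Prod>l\<in>UNIV. pconst (bernstein_coeff a m (\<alpha> $ l) (\<iota> l)) *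
          bernstein m (\<iota> l) (u l) (v l))"
        by (rule prod_sum_PiE) auto
      finally show ?thesis by (simp add: prod.distrib pconst_prod)
    qed
    have "p = (\<Sum>\<alpha>\<in>Poly_Mapping.keys p. pconst (Poly_Mapping.lookup p \<alpha>) * monomial \<alpha>)"
      by (rule poly_expand) auto
    also have "\<dots> = (\<Sum>\<alpha>\<in>Poly_Mapping.keys p. \<Sum>\<iota>\<in>?J. pconst (Poly_Mapping.lookup p \<alpha> *
        (\<Prod>l\<in>UNIV. bernstein_coeff a m (\<alpha> $ l) (\<iota> l))) * (\<Prod>l\<in>UNIV. bernstein m (\<iota> l) (u l) (v l)))"
      by (intro sum.cong refl) (simp add: mono sum_distrib_left pconst_hom(4) mult.assoc)
    also have "\<dots> = (\<Sum>\<iota>\<in>?J. \<Sum>\<alpha>\<in>Poly_Mapping.keys p. pconst (Poly_Mapping.lookup p \<alpha> *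
        (\<Prod>l\<in>UNIV. bernstein_coeff a m (\<alpha> $ l) (\<iota> l))) * (\<Prod>l\<in>UNIV. bernstein m (\<iota> l) (u l) (v l)))"
      by (rule sum.swap)
    finally show ?thesis
      by (simp only: coeff_def pconst_sum sum_distrib_right)
  qed
  \<comment> \<open>The minimum of \<open>p\<close> over the compact box.\<close>
  obtain e where e: "e > 0" "\<And>x. (\<And>i. \<bar>x $ i\<bar> \<le> a) \<Longrightarrow> peval p x \<ge> e"
  proof -
    let ?B = "cbox (\<chi> i. - a) (\<chi> i. a) :: (real ^ 'n) set"
    have B: "x \<in> ?B \<longleftrightarrow> (\<forall>i. \<bar>x $ i\<bar> \<le> a)" for x
      by (auto simp: mem_box_cart abs_le_iff minus_le_iff)
    have "0 \<in> ?B" using assms(1) by (simp add: B)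
    then have "\<exists>x\<in>?B. \<forall>y\<in>?B. peval p x \<le> peval p y"
      by (intro continuous_attains_inf compact_cbox continuous_on_subset[OF continuous_on_peval]) auto
    then obtain x where "x \<in> ?B" "\<And>y. y \<in> ?B \<Longrightarrow> peval p x \<le> peval p y"
      by blast
    then show ?thesis using that[of "peval p x"] pos B by auto
  qed
  \<comment> \<open>Otherwise each large degree has a negative coefficient, and the asymptotics
    along a sequence of such indices contradict the bound \<open>e\<close>.\<close>
  have "\<exists>m\<ge>pdeg p. \<forall>\<iota>. (\<forall>l. \<iota> l \<le> m) \<longrightarrow> coeff m \<iota> \<ge> 0"
  proof (rule ccontr)
    assume "\<not> ?thesis"
    then have neg: "\<exists>\<iota>. (\<forall>l. \<iota> l \<le> m) \<and> coeff m \<iota> < 0" if "m \<ge> pdeg p" for m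
      using that by (simp add: not_le) (metis not_le)
    \<comment> \<open>Below \<open>pdeg p\<close> the zero index is a filler, so that a sequence
      indexed by all \<open>m\<close> can be chosen.\<close>
    have "\<exists>\<iota>. (\<forall>l. \<iota> l \<le> m) \<and> (m \<ge> pdeg p \<longrightarrow> coeff m \<iota> < 0)" for m
      using neg[of m] by (cases "m \<ge> pdeg p") (auto intro: exI[of _ "\<lambda>_. 0"])
    then obtain \<iota> where \<iota>: "\<And>m l. \<iota> m l \<le> m" "\<And>m. m \<ge> pdeg p \<Longrightarrow> coeff m (\<iota> m) < 0"
      by metis
    \<comment> \<open>The grid point belonging to the index; it lies in the box.\<close>
    define x where "x m = (\<chi> l. 2 * a * (real (\<iota> m l) / real m) - a)" for m
    have "asymp_eq (\<lambda>m. coeff m (\<iota> m)) (\<lambda>m. peval p (x m))"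
      unfolding coeff_def peval_def monomial_eval_def x_def
      by (simp only: vec_lambda_beta)
        (intro asymp_eq_sum asymp_eq_mult asymp_eq_const asymp_eq_prod asymp_eq_bernstein_coeff \<iota>)
    then have "(\<lambda>m. coeff m (\<iota> m) - peval p (x m)) \<longlonglongrightarrow> 0" by (simp add: asymp_eq_def)
    then have "\<forall>\<^sub>F m in sequentially. coeff m (\<iota> m) - peval p (x m) > - e"
      using e(1) by (intro order_tendstoD) auto
    then have "\<forall>\<^sub>F m in sequentially. False"
      using eventually_ge_at_top[of "pdeg p"]
    proof eventually_elim
      case (elim m)
      have "\<bar>x m $ l\<bar> \<le> a" for l
      proof -
        have "real (\<iota> m l) / real m \<le> 1" "0 \<le> real (\<iota> m l) / real m"
          using \<iota>(1)[of m l] by (auto simp: divide_le_eq)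
        then have "a * (real (\<iota> m l) / real m) \<le> a" "0 \<le> a * (real (\<iota> m l) / real m)"
          using assms(1) by (auto intro: mult_left_le simp del: times_divide_eq_right)
        then show ?thesis by (simp add: x_def abs_le_iff)
      qed
      then show False using e(2)[of "x m"] \<iota>(2)[OF elim(2)] elim(1) by fastforce
    qed
    then show False by simp
  qed
  then obtain m where m: "pdeg p \<le> m" "\<And>\<iota>. (\<forall>l. \<iota> l \<le> m) \<Longrightarrow> coeff m \<iota> \<ge> 0" by auto
  show ?thesis
    by (subst expand[OF m(1)])
      (intro qmodule_sum qmodule_single_mult qmodule_single_prod bern_in qmodule_pconst m(2), auto)
qed

subsection \<open>Putinar's Positivstellensatz\<close>

text \<open>By Bernoulli, \<open>(1 + N * t) * (1 - t) ^ N\<close> is at most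
  \<open>(1 - t * t) ^ N\<close>, hence at most 1.\<close>

lemma mult_one_minus_power_le:
  fixes t :: real
  assumes "0 \<le> t" "t \<le> 1" "N > 0"
  shows "t * (1 - t) ^ N \<le> 1 / real N"
proof -
  have "(1 + real N * t) * (1 - t) ^ N \<le> (1 + t) ^ N * (1 - t) ^ N"
    using Bernoulli_inequality[of t N] assms by (intro mult_right_mono) (auto simp: mult.commute)
  also have "\<dots> = (1 - t * t) ^ N"
    by (simp add: power_mult_distrib[symmetric] algebra_simps)
  also have "\<dots> \<le> 1"
    using assms by (intro power_le_one) (auto simp: mult_le_one)
  finally have "real N * (t * (1 - t) ^ N) \<le> 1 - (1 - t) ^ N"
    by (simp add: algebra_simps)
  also have "\<dots> \<le> 1" using assms by simp
  finally show ?thesis using assms(3) by (simp add: field_simps)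
qed

text \<open>On a compact set \<open>B\<close>, subtracting a large multiple of the polynomials
  \<open>t * (1 - t) ^ (2 * k)\<close>, \<open>t = p / G\<close>, \<open>p \<in> set g\<close>, pushes \<open>f\<close> up where some \<open>p < 0\<close>
  and hardly changes it where \<open>p \<ge> 0\<close>.\<close>

lemma positive_on_compact_perturbation:
  fixes f :: "'n::finite rpoly"
  assumes "compact B" and pos: "\<forall>x\<in>semialg h g. peval f x > 0"
  obtains G c k where "G > 0" "c \<ge> 0"
    "\<And>x. x \<in> B \<Longrightarrow> peval (f + (\<Sum>p\<in>set h. pconst c * p ^ 2)
       - (\<Sum>p\<in>set g. pconst c * (pconst (1 / G) * p * ((1 - pconst (1 / G) * p) ^ k) ^ 2))) x > 0"
proof -
  have cont: "continuous_on S (peval p)" for S and p :: "'n rpoly"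
    using continuous_on_subset[OF continuous_on_peval] by blast
  have bnd: "\<exists>b. \<forall>x\<in>B. \<bar>peval p x\<bar> \<le> b" for p :: "'n rpoly"
  proof -
    have "bounded (peval p ` B)"
      using assms(1) cont by (intro compact_imp_bounded compact_continuous_image)
    then show ?thesis by (auto simp: bounded_iff)
  qed
  then obtain \<beta> where \<beta>: "\<And>p x. x \<in> B \<Longrightarrow> \<bar>peval p x\<bar> \<le> \<beta> p" by metis
  \<comment> \<open>Scales all weights at once so that \<open>p / G \<le> 1\<close> on
    \<open>B\<close>; the summand 1 keeps \<open>G\<close> positive.\<close>
  define G where "G = 1 + (\<Sum>p\<in>set g. \<bar>\<beta> p\<bar>)"
  have G: "G > 0" unfolding G_def by (smt (verit) sum_nonneg abs_ge_zero)
  have G_le: "peval p x \<le> G" if "x \<in> B" "p \<in> set g" for p x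
  proof -
    have "\<bar>\<beta> p\<bar> \<le> (\<Sum>p\<in>set g. \<bar>\<beta> p\<bar>)" by (rule member_le_sum) (use that in auto)
    then show ?thesis using \<beta>[OF that(1), of p] by (simp add: G_def)
  qed
  \<comment> \<open>A continuous penalty for violated constraints, whose zeros are feasible.\<close>
  define F where "F x = (\<Sum>p\<in>set h. (peval p x) ^ 2) + (\<Sum>p\<in>set g. max 0 (- peval p x / G))" for x
  have F_nonneg: "F x \<ge> 0" for x unfolding F_def by (intro add_nonneg_nonneg sum_nonneg) auto
  have F_zero: "x \<in> semialg h g" if "F x = 0" for x
  proof -
    have "(\<Sum>p\<in>set h. (peval p x) ^ 2) = 0" "(\<Sum>p\<in>set g. max 0 (- peval p x / G)) = 0"
      using that by (simp_all add: F_def add_nonneg_eq_0_iff sum_nonneg)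
    then have "\<forall>p\<in>set h. peval p x = 0" "\<forall>p\<in>set g. max 0 (- peval p x / G) = 0"
      by (simp_all add: sum_nonneg_eq_0_iff)
    then show ?thesis using G by (auto simp: semialg_def max_def divide_simps split: if_splits)
  qed
  obtain e where e: "e > 0" "\<And>x. x \<in> B \<Longrightarrow> x \<in> semialg h g \<Longrightarrow> peval f x > e"
  proof (cases "B \<inter> semialg h g = {}")
    case True
    then show ?thesis using that[of 1] by auto
  next
    case False
    have "\<exists>x\<in>B \<inter> semialg h g. \<forall>y\<in>B \<inter> semialg h g. peval f x \<le> peval f y"
      using assms(1) False by (intro continuous_attains_inf compact_Int_closed closed_semialg cont)
    then obtain x where "x \<in> semialg h g" "\<And>y. y \<in> B \<Longrightarrow> y \<in> semialg h g \<Longrightarrow> peval f x \<le> peval f y"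
      by blast
    then show ?thesis using that[of "peval f x / 2"] pos by force
  qed
  \<comment> \<open>The part of \<open>B\<close> where \<open>f\<close> needs help. It contains no
    feasible point, so the penalty has a positive minimum on it.\<close>
  define U where "U = B \<inter> {x. peval f x \<le> e}"
  have "compact U"
    unfolding U_def using assms(1)
    by (intro compact_Int_closed closed_Collect_le continuous_on_peval continuous_on_const)
  obtain d where d: "d > 0" "\<And>x. x \<in> U \<Longrightarrow> F x \<ge> d"
  proof (cases "U = {}")
    case True
    then show ?thesis using that[of 1] by auto
  next
    case False
    have "continuous_on U F" unfolding F_def by (intro continuous_intros cont) (use G in auto)
    then have "\<exists>x\<in>U. \<forall>y\<in>U. F x \<le> F y"
      using False \<open>compact U\<close> by (intro continuous_attains_inf)
    then obtain x where x: "x \<in> U" "\<And>y. y \<in> U \<Longrightarrow> F x \<le> F y" by blast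
    have "F x \<noteq> 0" using F_zero[of x] x(1) e(2)[of x] by (auto simp: U_def)
    then show ?thesis using that[of "F x"] x F_nonneg[of x] by auto
  qed
  define P where "P = \<bar>\<beta> f\<bar>"
  \<comment> \<open>Chosen so that on \<open>U\<close> the term \<open>c * F x\<close> outweighs the
    lower bound \<open>- P\<close> of \<open>f\<close> with a margin of
    \<open>e + 1\<close>.\<close>
  define c where "c = (P + e + 1) / d"
  have c: "c \<ge> 0" "c * d = P + e + 1" using d(1) e(1) by (simp_all add: c_def P_def)
  define C where "C = c * real (card (set g))"
  \<comment> \<open>Makes the total error \<open>C / (2 * k')\<close> smaller than \<open>e\<close>;
    the successor keeps the exponent positive.\<close>
  obtain k :: nat where k: "C / e < real k" using reals_Archimedean2 by blast
  define k' where "k' = Suc k"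
  have Ck: "C / real (2 * k') < e"
  proof -
    have "C < e * real k" using k e(1) by (simp add: field_simps)
    also have "\<dots> \<le> e * real (2 * k')" using e(1) by (intro mult_left_mono) (auto simp: k'_def)
    finally show ?thesis by (simp add: k'_def field_simps)
  qed
  show ?thesis
  proof (rule that[OF G c(1), of k'])
    fix x assume x: "x \<in> B"
    define t where "t p = peval p x / G" for p
    \<comment> \<open>For \<open>t p \<ge> 0\<close> the maximum is 0 and the Bernoulli bound
      applies. For \<open>t p < 0\<close> the power is at least 1, so the product is at most
      \<open>t p\<close>.\<close>
    have "t p * (1 - t p) ^ (2 * k') \<le> 1 / real (2 * k') - max 0 (- t p)" if "p \<in> set g" for p
    proof (cases "t p \<ge> 0")
      case True
      moreover have "t p \<le> 1" using G_le[OF x that] G by (simp add: t_def)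
      ultimately show ?thesis using mult_one_minus_power_le[of "t p" "2 * k'"] by (simp add: k'_def)
    next
      case False
      then have "1 \<le> (1 - t p) ^ (2 * k')" by (intro one_le_power) auto
      then have "t p * (1 - t p) ^ (2 * k') \<le> t p * 1"
        using False by (intro mult_left_mono_neg) auto
      moreover have "0 \<le> 1 / real (2 * k')" by simp
      ultimately show ?thesis using False by linarith
    qed
    then have "(\<Sum>p\<in>set g. t p * (1 - t p) ^ (2 * k')) \<le>
        (\<Sum>p\<in>set g. 1 / real (2 * k') - max 0 (- t p))"
      by (rule sum_mono)
    also have "\<dots> = real (card (set g)) / real (2 * k') - (\<Sum>p\<in>set g. max 0 (- peval p x / G))"
      by (simp add: sum_subtractf t_def)
    finally have "F x - real (card (set g)) / real (2 * k') \<le>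
        (\<Sum>p\<in>set h. (peval p x) ^ 2) - (\<Sum>p\<in>set g. t p * (1 - t p) ^ (2 * k'))"
      by (simp add: F_def)
    then have "c * (F x - real (card (set g)) / real (2 * k')) \<le>
        c * ((\<Sum>p\<in>set h. (peval p x) ^ 2) - (\<Sum>p\<in>set g. t p * (1 - t p) ^ (2 * k')))"
      using c(1) by (rule mult_left_mono)
    then have 1: "c * F x - C / real (2 * k') \<le>
        c * (\<Sum>p\<in>set h. (peval p x) ^ 2) - c * (\<Sum>p\<in>set g. t p * (1 - t p) ^ (2 * k'))"
      by (simp add: right_diff_distrib C_def)
    have 2: "peval (f + (\<Sum>p\<in>set h. pconst c * p ^ 2)
       - (\<Sum>p\<in>set g. pconst c * (pconst (1 / G) * p * ((1 - pconst (1 / G) * p) ^ k') ^ 2))) x =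
       peval f x + (c * (\<Sum>p\<in>set h. (peval p x) ^ 2) - c * (\<Sum>p\<in>set g. t p * (1 - t p) ^ (2 * k')))"
      by (simp add: peval_simps t_def sum_distrib_left power_even_eq)
    have 3: "peval f x + c * F x - C / real (2 * k') > 0"
    proof (cases "x \<in> U")
      case True
      then have "c * F x \<ge> P + e + 1" using mult_left_mono[OF d(2) c(1)] c(2) by auto
      moreover have "peval f x \<ge> - P" using \<beta>[OF x, of f] by (simp add: P_def)
      ultimately show ?thesis using Ck by linarith
    next
      case False
      then have "peval f x > e" using x by (simp add: U_def)
      moreover have "c * F x \<ge> 0" using c(1) F_nonneg[of x] by simp
      ultimately show ?thesis using Ck by linarith
    qed
    show "peval (f + (\<Sum>p\<in>set h. pconst c * p ^ 2)
       - (\<Sum>p\<in>set g. pconst c * (pconst (1 / G) * p * ((1 - pconst (1 / G) * p) ^ k') ^ 2))) x > 0"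
      unfolding 2 using 1 3 by linarith
  qed
qed

lemma archimedean_qmodule:
  fixes h g :: "'n::finite rpoly list"
  assumes "archimedean h g"
  obtains R where "R > 0" "pconst R - (\<Sum>i\<in>UNIV. pvar i ^ 2) \<in> qmodule h g"
proof -
  obtain R a b where R: "R > 0" "a \<in> poly_ideal h" "b \<in> quad_module g"
    "pconst R - (\<Sum>i\<in>UNIV. pvar i ^ 2) = a + b"
    using assms unfolding archimedean_def by blast
  show ?thesis
  proof (rule that[OF R(1)])
    show "pconst R - (\<Sum>i\<in>UNIV. pvar i ^ 2) \<in> qmodule h g"
      unfolding R(4) by (rule ideal_plus_quad_module_subset[OF R(2,3)])
  qed
qed

text \<open>The perturbed polynomial \<open>f + r - s\<close> is positive on a box and so has a
  certificate from the ball polynomial alone; the corrections \<open>s\<close> and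
  \<open>- r\<close> are themselves in the module.\<close>

theorem putinar_positivstellensatz:
  fixes f :: "'n::finite rpoly"
  assumes "archimedean h g" and pos: "\<forall>x\<in>semialg h g. peval f x > 0"
  shows "f \<in> qmodule h g"
proof -
  obtain R where R: "R > 0" "pconst R - (\<Sum>i\<in>UNIV. pvar i ^ 2) \<in> qmodule h g"
    using archimedean_qmodule[OF assms(1)] .
  define b :: "'n rpoly" where "b = pconst R - (\<Sum>i\<in>UNIV. pvar i ^ 2)"
  \<comment> \<open>The bound on the variables certified by
    \<open>pvar_bounds_in_ball_qmodule\<close>.\<close>
  define a where "a = (1 + R) / 2"
  have a: "a > 0" using R(1) by (simp add: a_def)
  let ?B = "cbox (\<chi> i. - a) (\<chi> i. a) :: (real ^ 'n) set"
  obtain G c k where Gck: "G > 0" "c \<ge> 0"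
    and pos': "\<And>x. x \<in> ?B \<Longrightarrow> peval (f + (\<Sum>p\<in>set h. pconst c * p ^ 2)
       - (\<Sum>p\<in>set g. pconst c * (pconst (1 / G) * p * ((1 - pconst (1 / G) * p) ^ k) ^ 2))) x > 0"
    by (rule positive_on_compact_perturbation[OF compact_cbox[of "\<chi> i. - a" "\<chi> i. a"] pos]) (rule that)
  define s where "s = (\<Sum>p\<in>set g. pconst c * (pconst (1 / G) * p * ((1 - pconst (1 / G) * p) ^ k) ^ 2))"
  define r where "r = (\<Sum>p\<in>set h. pconst c * p ^ 2)"
  have "f + r - s \<in> qmodule [] [b]"
  proof (rule positive_on_box_in_qmodule[OF a])
    show "pconst a + pvar i \<in> qmodule [] [b]" "pconst a - pvar i \<in> qmodule [] [b]" for i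
      unfolding a_def by (rule pvar_bounds_in_ball_qmodule[OF R(1) b_def])+
    show "peval (f + r - s) x > 0" if "\<And>i. \<bar>x $ i\<bar> \<le> a" for x
    proof -
      have "x \<in> ?B" using that by (auto simp: mem_box_cart abs_le_iff minus_le_iff)
      then show ?thesis unfolding r_def s_def by (rule pos')
    qed
  qed
  then have 1: "f + r - s \<in> qmodule h g"
    using qmodule_mono R(2) unfolding b_def by blast
  have 2: "s \<in> qmodule h g"
    unfolding s_def mult.assoc[of "pconst (1 / G)"] using Gck
    by (intro qmodule_sum qmodule_pconst_mult qmodule.weight) auto
  \<comment> \<open>The sign is harmless since \<open>r\<close> lies in the ideal.\<close>
  have "- r = (\<Sum>p\<in>set h. p * (- pconst c * p))"
    by (simp add: r_def sum_negf power2_eq_square mult.left_commute)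
  also have "\<dots> \<in> qmodule h g" by (intro qmodule_sum qmodule.ideal)
  finally have 3: "- r \<in> qmodule h g" .
  show ?thesis using qmodule.add[OF qmodule.add[OF 1 2] 3] by simp
qed

section \<open>Compactness of the feasible set and eventual positivity of truncated
  functionals\<close>

lemma compact_semialg:
  assumes "archimedean h g"
  shows "compact (semialg h g)"
proof -
  obtain R where R: "R > 0" "pconst R - (\<Sum>i\<in>UNIV. pvar i ^ 2) \<in> qmodule h g"
    using archimedean_qmodule[OF assms] .
  have "norm x \<le> sqrt R" if "x \<in> semialg h g" for x
    using peval_qmodule_nonneg[OF R(2) that]
    by (simp add: peval_simps norm_vec_def L2_set_def)
  then show ?thesis
    using closed_semialg by (auto simp: compact_eq_bounded_closed bounded_iff)
qed

text \<open>A certificate has finitely many terms of fixed degree. Once \<open>2 * k\<close> exceeds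
  these degrees, positive semidefinite localizing matrices handle the square terms and vanishing
  ones the ideal terms, for all \<open>z\<close> simultaneously.\<close>

lemma qmodule_riesz_nonneg:
  assumes "p \<in> qmodule h g"
  shows "\<forall>\<^sub>F k in sequentially. \<forall>z\<in>Phi_set k g \<inter> E_set k h. riesz z p \<ge> 0"
proof -
  have psd: "\<forall>\<^sub>F k in sequentially. \<forall>z\<in>Phi_set k g \<inter> E_set k h. riesz z (p * q ^ 2) \<ge> 0"
    if p: "p \<in> set (1 # g)" for p q
    using eventually_ge_at_top[of "pdeg (p * q ^ 2)"]
  proof eventually_elim
    case (elim k)
    show ?case
    proof
      fix z assume "z \<in> Phi_set k g \<inter> E_set k h"
      then have psd: "psd_on (loc_index p k) (loc_matrix p k z)" using p by (auto simp: Phi_set_def)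
      have "is_loc_matrix p k z (loc_matrix p k z)"
        by (simp add: loc_matrix_def is_loc_matrix_iff)
      then have "riesz z (p * q ^ 2) = quad_form (loc_index p k) (loc_matrix p k z) (Poly_Mapping.lookup q)"
        using elim by (simp add: is_loc_matrix_def)
      then show "riesz z (p * q ^ 2) \<ge> 0" using psd by (simp add: psd_on_def)
    qed
  qed
  show ?thesis
    using assms
  proof induction
    case (square q)
    then show ?case using psd[of 1 q] by simp
  next
    case (weight p q)
    then show ?case using psd[of p q] by simp
  next
    case (ideal p q)
    show ?case
      \<comment> \<open>Large enough to index row \<open>\<alpha>\<close> and column 0 for every
        exponent of \<open>q\<close>; that matrix entry is
        \<open>riesz z (p * monomial \<alpha>)\<close>.\<close>
      using eventually_ge_at_top[of "pdeg p + pdeg q"]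
    proof eventually_elim
      case (elim k)
      show ?case
      proof
        fix z assume z: "z \<in> Phi_set k g \<inter> E_set k h"
        have "riesz z (p * monomial \<alpha>) = 0" if "\<alpha> \<in> Poly_Mapping.keys q" for \<alpha>
        proof -
          have "\<alpha> \<in> loc_index p k" "0 \<in> loc_index p k"
            using elim expo_deg_le_pdeg[OF that] by (auto simp: loc_index_def expo_deg_def)
          then show ?thesis
            using z ideal loc_matrix_entry[of \<alpha> p k 0 z] by (auto simp: E_set_def)
        qed
        then have "(\<Sum>\<alpha>\<in>Poly_Mapping.keys q.
            riesz z (pconst (Poly_Mapping.lookup q \<alpha>) * (p * monomial \<alpha>))) = 0"
          by (simp add: riesz_pconst_mult)
        moreover have "p * q = (\<Sum>\<alpha>\<in>Poly_Mapping.keys q. pconst (Poly_Mapping.lookup q \<alpha>) * (p * monomial \<alpha>))"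
          by (subst poly_expand[of "Poly_Mapping.keys q" q])
            (simp_all add: sum_distrib_left mult.left_commute)
        ultimately show "riesz z (p * q) \<ge> 0" by (simp add: riesz_sum)
      qed
    qed
  next
    case (add p q)
    from add.IH show ?case
      by eventually_elim (auto simp: riesz_add)
  qed
qed

subsection \<open>Convergence of the relaxations\<close>

text \<open>By the Positivstellensatz \<open>P = c * f - q\<close> lies in the quadratic module, so
  \<open>riesz z P \<ge> 0\<close> eventually; with \<open>riesz z f = 1\<close> this is the claimed
  bound.\<close>

lemma valid_inequality_S_section:
  fixes f :: "'n::finite rpoly"
  assumes "finite A" "archimedean h g" "f \<in> poly_span A"
    and lt: "\<And>x. x \<in> semialg h g \<Longrightarrow> (\<Sum>\<alpha>\<in>A. p \<alpha> * monomial_eval \<alpha> x) < c * peval f x"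
  shows "\<forall>\<^sub>F k in sequentially. \<forall>z\<in>S_section h g A k f. (\<Sum>\<alpha>\<in>A. p \<alpha> * z \<alpha>) \<le> c"
proof -
  have keys_f: "Poly_Mapping.keys f \<subseteq> A" using assms(1,3) by (simp add: poly_span_iff)
  define q where "q = (\<Sum>\<alpha>\<in>A. pconst (p \<alpha>) * monomial \<alpha>)"
  define P where "P = pconst c * f - q"
  have riesz_P: "riesz z P = c * riesz z f - (\<Sum>\<alpha>\<in>A. p \<alpha> * z \<alpha>)" for z
  proof -
    have "P = pconst c * f + pconst (- 1) * q" by (simp add: P_def pconst_hom)
    then show ?thesis by (simp add: riesz_add riesz_pconst_mult q_def riesz_sum riesz_monomial)
  qed
  have "\<forall>x\<in>semialg h g. peval P x > 0"
    using lt by (simp add: peval_eq_riesz riesz_P)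
  then have "P \<in> qmodule h g" by (rule putinar_positivstellensatz[OF assms(2)])
  then have "\<forall>\<^sub>F k in sequentially. \<forall>z\<in>Phi_set k g \<inter> E_set k h. riesz z P \<ge> 0"
    by (rule qmodule_riesz_nonneg)
  then show ?thesis
    \<comment> \<open>Excludes the branch of \<open>S_relax\<close> that is the whole space.\<close>
    using eventually_ge_at_top[of "set_deg A"]
  proof eventually_elim
    case (elim k)
    show ?case
    proof
      fix y assume y: "y \<in> S_section h g A k f"
      moreover have "real k \<ge> real (set_deg A) / 2" using elim(2) by simp
      ultimately obtain z where z: "y = restrict z A" "z \<in> Phi_set k g \<inter> E_set k h"
        by (auto simp: S_section_def S_relax_def)
      have "pairing A f y = riesz z f"
        using riesz_superset[OF assms(1) keys_f, of z] by (simp add: pairing_def z(1))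
      then have "riesz z f = 1" using y by (simp add: S_section_def)
      moreover have "riesz z P \<ge> 0" using elim(1) z(2) by blast
      ultimately show "(\<Sum>\<alpha>\<in>A. p \<alpha> * y \<alpha>) \<le> c"
        by (simp add: riesz_P z(1))
    qed
  qed
qed

section \<open>Normalised moment vectors of finitely atomic measures\<close>

text \<open>The numbers \<open>c x * peval f x\<close> act as convex weights: for \<open>f\<close>
  positive on \<open>K\<close> this is the convex hull of the normalised point evaluations.\<close>

definition atomic_section ::
  "'n::finite expo set \<Rightarrow> (real ^ 'n) set \<Rightarrow> 'n rpoly \<Rightarrow> ('n expo \<Rightarrow> real) set" where
  "atomic_section A K f = {\<lambda>\<alpha>\<in>A. \<Sum>x\<in>F. c x * monomial_eval \<alpha> x | F c.
     finite F \<and> F \<subseteq> K \<and> (\<forall>x\<in>F. c x \<ge> 0) \<and> (\<Sum>x\<in>F. c x * peval f x) = 1}"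

lemma atomic_section_subset:
  fixes f :: "'n::finite rpoly"
  assumes "finite A" "f \<in> poly_span A"
  shows "atomic_section A K f \<subseteq> R_section A K f"
proof
  fix y assume "y \<in> atomic_section A K f"
  then obtain F c where y: "y = (\<lambda>\<alpha>\<in>A. \<Sum>x\<in>F. c x * monomial_eval \<alpha> x)"
    and F: "finite F" "F \<subseteq> K" "\<And>x. x \<in> F \<Longrightarrow> c x \<ge> 0" "(\<Sum>x\<in>F. c x * peval f x) = 1"
    by (auto simp: atomic_section_def)
  \<comment> \<open>The point measure lives on the power set of \<open>F\<close>; pushing it forward
    along the identity gives a Borel measure.\<close>
  define M where "M = point_measure F (\<lambda>x. ennreal (c x))"
  have meas: "(\<lambda>x. x) \<in> measurable M borel"
    by (simp add: M_def measurable_point_measure_eq1)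
  have mono: "monomial_eval \<alpha> \<in> borel_measurable borel" for \<alpha> :: "'n expo"
    unfolding monomial_eval_def by (intro borel_measurable_continuous_onI continuous_intros)
  have "y \<in> moment_cone A K"
    unfolding moment_cone_def
  proof (intro CollectI conjI exI[of _ "distr M borel (\<lambda>x. x)"] ballI)
    show "y \<in> real_vecs A" by (simp add: y)
    show "sets (distr M borel (\<lambda>x. x)) = sets borel" by simp
    show "emeasure (distr M borel (\<lambda>x. x)) (- K) = 0"
    \<comment> \<open>\<open>K\<close> is arbitrary here; a set that is not measurable has
      \<open>emeasure\<close> 0 by convention.\<close>
    proof (cases "- K \<in> sets borel")
      case True
      have "space M = F" by (simp add: M_def space_point_measure)
      then have "(\<lambda>x. x) -` (- K) \<inter> space M = {}" using F(2) by auto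
      then show ?thesis using True meas by (simp add: emeasure_distr)
    next
      case False
      then show ?thesis by (simp add: emeasure_notin_sets)
    qed
    fix \<alpha> assume \<alpha>: "\<alpha> \<in> A"
    show "integrable (distr M borel (\<lambda>x. x)) (monomial_eval \<alpha>)"
      unfolding integrable_distr_eq[OF meas mono] unfolding M_def
      by (rule integrable_point_measure_finite[OF F(1)])
    show "y \<alpha> = integral\<^sup>L (distr M borel (\<lambda>x. x)) (monomial_eval \<alpha>)"
      unfolding integral_distr[OF meas mono] unfolding M_def
      using \<alpha> F(1,3) by (simp add: lebesgue_integral_point_measure_finite y)
  qed
  moreover have "pairing A f y = 1"
  proof -
    have keys: "Poly_Mapping.keys f \<subseteq> A" using assms by (simp add: poly_span_iff)
    have "pairing A f y = (\<Sum>\<alpha>\<in>A. \<Sum>x\<in>F. c x * (Poly_Mapping.lookup f \<alpha> * monomial_eval \<alpha> x))"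
      by (simp add: pairing_def y sum_distrib_left mult.left_commute)
    also have "\<dots> = (\<Sum>x\<in>F. c x * (\<Sum>\<alpha>\<in>A. Poly_Mapping.lookup f \<alpha> * monomial_eval \<alpha> x))"
      by (subst sum.swap) (simp add: sum_distrib_left)
    also have "\<dots> = (\<Sum>x\<in>F. c x * peval f x)"
      by (simp add: peval_eq_riesz riesz_superset[OF assms(1) keys])
    finally show ?thesis using F(4) by simp
  qed
  ultimately show "y \<in> R_section A K f" by (simp add: R_section_def)
qed

lemma point_in_atomic_section:
  assumes "x \<in> K" "peval f x > 0"
  shows "(\<lambda>\<alpha>\<in>A. monomial_eval \<alpha> x / peval f x) \<in> atomic_section A K f"
  unfolding atomic_section_def
  by (rule CollectI, rule exI[of _ "{x}"], rule exI[of _ "\<lambda>_. 1 / peval f x"]) (use assms in auto)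

lemma atomic_section_convex:
  assumes "y \<in> atomic_section A K f" "y' \<in> atomic_section A K f" "0 \<le> t" "t \<le> 1"
  shows "(\<lambda>\<alpha>\<in>A. (1 - t) * y \<alpha> + t * y' \<alpha>) \<in> atomic_section A K f"
proof -
  obtain F c where y: "y = (\<lambda>\<alpha>\<in>A. \<Sum>x\<in>F. c x * monomial_eval \<alpha> x)"
    and F: "finite F" "F \<subseteq> K" "\<And>x. x \<in> F \<Longrightarrow> c x \<ge> 0" "(\<Sum>x\<in>F. c x * peval f x) = 1"
    using assms(1) by (auto simp: atomic_section_def)
  obtain F' c' where y': "y' = (\<lambda>\<alpha>\<in>A. \<Sum>x\<in>F'. c' x * monomial_eval \<alpha> x)"
    and F': "finite F'" "F' \<subseteq> K" "\<And>x. x \<in> F' \<Longrightarrow> c' x \<ge> 0" "(\<Sum>x\<in>F'. c' x * peval f x) = 1"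
    using assms(2) by (auto simp: atomic_section_def)
  \<comment> \<open>Both weights are extended by zero to the union of the supports.\<close>
  define d where "d x = (1 - t) * (if x \<in> F then c x else 0) + t * (if x \<in> F' then c' x else 0)" for x
  have d: "(\<Sum>x\<in>F \<union> F'. d x * \<phi> x) = (1 - t) * (\<Sum>x\<in>F. c x * \<phi> x) + t * (\<Sum>x\<in>F'. c' x * \<phi> x)"
    for \<phi> :: "_ \<Rightarrow> real"
  proof -
    have "(\<Sum>x\<in>F. c x * \<phi> x) = (\<Sum>x\<in>F \<union> F'. (if x \<in> F then c x else 0) * \<phi> x)"
      using F(1) F'(1) by (intro sum.mono_neutral_cong_left) auto
    moreover have "(\<Sum>x\<in>F'. c' x * \<phi> x) = (\<Sum>x\<in>F \<union> F'. (if x \<in> F' then c' x else 0) * \<phi> x)"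
      using F(1) F'(1) by (intro sum.mono_neutral_cong_left) auto
    ultimately show ?thesis
      by (simp only: d_def distrib_right sum.distrib sum_distrib_left mult.assoc)
  qed
  show ?thesis
    unfolding atomic_section_def
  proof (intro CollectI exI conjI)
    show "(\<lambda>\<alpha>\<in>A. (1 - t) * y \<alpha> + t * y' \<alpha>) = (\<lambda>\<alpha>\<in>A. \<Sum>x\<in>F \<union> F'. d x * monomial_eval \<alpha> x)"
      unfolding d by (auto simp: y y')
    show "\<forall>x\<in>F \<union> F'. 0 \<le> d x" using F(3) F'(3) assms(3,4) by (auto simp: d_def)
    show "(\<Sum>x\<in>F \<union> F'. d x * peval f x) = 1" unfolding d F(4) F'(4) by simp
  qed (use F F' in auto)
qed

text \<open>The hypothesis is averaged with the weights \<open>c x\<close>, and the normalisation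
  turns the right-hand side into \<open>b\<close>.\<close>

lemma atomic_section_bounded:
  assumes "y \<in> atomic_section A K f" "\<alpha> \<in> A"
    and "\<And>x. x \<in> K \<Longrightarrow> \<bar>monomial_eval \<alpha> x\<bar> \<le> b * peval f x"
  shows "\<bar>y \<alpha>\<bar> \<le> b"
proof -
  obtain F c where y: "y = (\<lambda>\<alpha>\<in>A. \<Sum>x\<in>F. c x * monomial_eval \<alpha> x)"
    and F: "finite F" "F \<subseteq> K" "\<And>x. x \<in> F \<Longrightarrow> c x \<ge> 0" "(\<Sum>x\<in>F. c x * peval f x) = 1"
    using assms(1) by (auto simp: atomic_section_def)
  have "\<bar>y \<alpha>\<bar> \<le> (\<Sum>x\<in>F. \<bar>c x * monomial_eval \<alpha> x\<bar>)"
    using assms(2) by (simp add: y)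
  also have "\<dots> \<le> (\<Sum>x\<in>F. c x * (b * peval f x))"
    using F assms(3) by (intro sum_mono) (auto simp: abs_mult intro!: mult_left_mono)
  also have "\<dots> = b * (\<Sum>x\<in>F. c x * peval f x)"
    by (simp add: sum_distrib_left mult.left_commute)
  finally show ?thesis using F(4) by simp
qed

section \<open>Separation and compactness for finite real vectors\<close>

text \<open>\<open>C\<close> need not be closed, so a nearly nearest point \<open>y\<close> replaces
  the projection of \<open>w\<close>; boundedness of \<open>C\<close> controls the second-order
  error, and \<open>w - y\<close> is the separating direction.\<close>

lemma strict_separation_convex_bounded:
  fixes w :: "'a \<Rightarrow> real"
  assumes "C \<noteq> {}"
    and conv: "\<And>y y' t. y \<in> C \<Longrightarrow> y' \<in> C \<Longrightarrow> 0 \<le> t \<Longrightarrow> t \<le> 1 \<Longrightarrow>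
      (\<lambda>\<alpha>\<in>A. (1 - t) * y \<alpha> + t * y' \<alpha>) \<in> C"
    and bnd: "\<And>y \<alpha>. y \<in> C \<Longrightarrow> \<alpha> \<in> A \<Longrightarrow> \<bar>y \<alpha>\<bar> \<le> b \<alpha>"
    and "e > 0" and far: "\<And>y. y \<in> C \<Longrightarrow> L2_set (\<lambda>\<alpha>. w \<alpha> - y \<alpha>) A \<ge> e"
  obtains p c where "\<And>y. y \<in> C \<Longrightarrow> (\<Sum>\<alpha>\<in>A. p \<alpha> * y \<alpha>) < c" "(\<Sum>\<alpha>\<in>A. p \<alpha> * w \<alpha>) > c"
proof -
  define S where "S y = (\<Sum>\<alpha>\<in>A. (w \<alpha> - y \<alpha>)\<^sup>2)" for y
  define d where "d = Inf (S ` C)"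
  have S_ge: "S y \<ge> e\<^sup>2" if "y \<in> C" for y
    using power_mono[OF far[OF that], of 2] \<open>e > 0\<close> by (simp add: L2_set_def S_def sum_nonneg)
  then have bdd: "bdd_below (S ` C)" by (auto simp: bdd_below_def)
  have d_le: "d \<le> S y" if "y \<in> C" for y
    unfolding d_def using that bdd by (intro cInf_lower) auto
  have "d \<ge> e\<^sup>2" unfolding d_def using assms(1) S_ge by (intro cInf_greatest) auto
  then have d: "d > 0" using \<open>e > 0\<close> by (smt (verit) zero_less_power)
  \<comment> \<open>A positive bound on the squared diameter of \<open>C\<close>.\<close>
  define D where "D = 1 + (\<Sum>\<alpha>\<in>A. (2 * b \<alpha>)\<^sup>2)"
  have D: "D > 0" unfolding D_def by (smt (verit) sum_nonneg zero_le_power2)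
  have D_ge: "(\<Sum>\<alpha>\<in>A. (y' \<alpha> - y \<alpha>)\<^sup>2) \<le> D" if "y \<in> C" "y' \<in> C" for y y'
  proof -
    have "(\<Sum>\<alpha>\<in>A. (y' \<alpha> - y \<alpha>)\<^sup>2) \<le> (\<Sum>\<alpha>\<in>A. (2 * b \<alpha>)\<^sup>2)"
    proof (rule sum_mono)
      fix \<alpha> assume "\<alpha> \<in> A"
      then have "\<bar>y' \<alpha> - y \<alpha>\<bar> \<le> \<bar>2 * b \<alpha>\<bar>"
        using bnd[OF that(1)] bnd[OF that(2)] by (smt (verit))
      then show "(y' \<alpha> - y \<alpha>)\<^sup>2 \<le> (2 * b \<alpha>)\<^sup>2" by (simp add: abs_le_square_iff)
    qed
    then show ?thesis by (simp add: D_def)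
  qed
  \<comment> \<open>The step is short enough that the quadratic term \<open>t\<^sup>2 * D\<close> is
    at most \<open>t * d / 2\<close>; the slack \<open>t * d / 2\<close> in the choice of
    \<open>y\<close> matches it.\<close>
  define t where "t = min 1 (d / (2 * D))"
  have t: "0 < t" "t \<le> 1" "t * D \<le> d / 2"
    using d D by (auto simp: t_def min_def field_simps)
  obtain y where y: "y \<in> C" "S y < d + t * d / 2"
  proof -
    have "d < d + t * d / 2" using t d by simp
    then have "\<exists>s\<in>S ` C. s < d + t * d / 2"
      unfolding d_def by (intro cInf_lessD) (use assms(1) in auto)
    then show ?thesis using that by auto
  qed
  define p where "p \<alpha> = w \<alpha> - y \<alpha>" for \<alpha>
  have inner: "(\<Sum>\<alpha>\<in>A. p \<alpha> * (y' \<alpha> - y \<alpha>)) \<le> d / 2" if y': "y' \<in> C" for y'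
  proof -
    let ?i = "\<Sum>\<alpha>\<in>A. p \<alpha> * (y' \<alpha> - y \<alpha>)" and ?n = "\<Sum>\<alpha>\<in>A. (y' \<alpha> - y \<alpha>)\<^sup>2"
    \<comment> \<open>Moving from \<open>y\<close> towards \<open>y'\<close> stays in
      \<open>C\<close>, so the squared distance to \<open>w\<close> cannot drop below its infimum
      \<open>d\<close>.\<close>
    have "d \<le> S (\<lambda>\<alpha>\<in>A. (1 - t) * y \<alpha> + t * y' \<alpha>)"
      using t by (intro d_le conv y(1) y') auto
    also have "\<dots> = (\<Sum>\<alpha>\<in>A. (w \<alpha> - y \<alpha>)\<^sup>2 - 2 * t * (p \<alpha> * (y' \<alpha> - y \<alpha>)) + t\<^sup>2 * (y' \<alpha> - y \<alpha>)\<^sup>2)"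
      unfolding S_def p_def by (intro sum.cong refl) (simp add: power2_eq_square algebra_simps)
    also have "\<dots> = S y - 2 * t * ?i + t\<^sup>2 * ?n"
      by (simp add: sum.distrib sum_subtractf sum_distrib_left S_def)
    finally have "2 * t * ?i \<le> (S y - d) + t\<^sup>2 * ?n" by simp
    also have "\<dots> \<le> t * d / 2 + t\<^sup>2 * D"
      using y(2) D_ge[OF y(1) y'] by (intro add_mono mult_left_mono) auto
    also have "t\<^sup>2 * D \<le> t * (d / 2)"
      using mult_left_mono[OF t(3), of t] t(1) by (simp add: power2_eq_square mult.assoc)
    finally have "t * (2 * ?i) \<le> t * d" by (simp add: algebra_simps)
    then show ?thesis using t(1) by simp
  qed
  show ?thesis
  \<comment> \<open>Relative to \<open>y\<close>, the functional is at most \<open>d / 2\<close> on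
    \<open>C\<close> and at least \<open>d\<close> at \<open>w\<close>; the threshold
    \<open>3 * d / 4\<close> lies between.\<close>
  proof (rule that[of p "(\<Sum>\<alpha>\<in>A. p \<alpha> * y \<alpha>) + 3 * d / 4"])
    show "(\<Sum>\<alpha>\<in>A. p \<alpha> * y' \<alpha>) < (\<Sum>\<alpha>\<in>A. p \<alpha> * y \<alpha>) + 3 * d / 4" if "y' \<in> C" for y'
      using inner[OF that] d by (simp add: right_diff_distrib sum_subtractf)
    have "(\<Sum>\<alpha>\<in>A. p \<alpha> * w \<alpha>) - (\<Sum>\<alpha>\<in>A. p \<alpha> * y \<alpha>) = S y"
      by (simp add: S_def p_def sum_subtractf[symmetric] power2_eq_square algebra_simps)
    then show "(\<Sum>\<alpha>\<in>A. p \<alpha> * w \<alpha>) > (\<Sum>\<alpha>\<in>A. p \<alpha> * y \<alpha>) + 3 * d / 4"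
      using d_le[OF y(1)] d by simp
  qed
qed

text \<open>Bolzano-Weierstrass, stated coordinatewise because the vectors are functions.\<close>

lemma bounded_vectors_convergent_subsequence:
  fixes z :: "nat \<Rightarrow> 'a \<Rightarrow> real"
  assumes "finite A" "\<And>j \<alpha>. \<alpha> \<in> A \<Longrightarrow> \<bar>z j \<alpha>\<bar> \<le> b \<alpha>"
  obtains w r where "strict_mono r" "\<And>\<alpha>. \<alpha> \<in> A \<Longrightarrow> (\<lambda>j. z (r j) \<alpha>) \<longlonglongrightarrow> w \<alpha>"
proof -
  have "bounded ((\<lambda>x. x \<alpha>) ` range z)" if "\<alpha> \<in> A" for \<alpha>
    unfolding bounded_iff using assms(2)[OF that] by auto
  then have "\<exists>l r. strict_mono r \<and>
      (\<forall>e>0. \<forall>\<^sub>F n in sequentially. \<forall>i\<in>A. dist (z (r n) i) (l i) < e)"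
    using compact_lemma_general[of A "\<lambda>x i. x i" z id] assms(1) by auto
  then obtain l r where r: "strict_mono r"
    and lim: "\<And>e. e > 0 \<Longrightarrow> \<forall>\<^sub>F n in sequentially. \<forall>i\<in>A. dist (z (r n) i) (l i) < e"
    by blast
  show ?thesis
  proof (rule that[OF r, of l])
    show "(\<lambda>j. z (r j) \<alpha>) \<longlonglongrightarrow> l \<alpha>" if "\<alpha> \<in> A" for \<alpha>
      unfolding tendsto_iff using that by (auto intro: eventually_mono[OF lim])
  qed
qed

text \<open>Otherwise a limit \<open>w\<close> of bad points could be separated from the hull by an
  inequality valid on all late relaxations, hence at \<open>w\<close>.\<close>

lemma eventually_close_to_atomic_section:
  fixes f :: "'n::finite rpoly"
  assumes ne: "semialg h g \<noteq> {}" and fin: "finite A" and arch: "archimedean h g"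
    and span: "f \<in> poly_span A" and pos: "\<forall>x\<in>semialg h g. peval f x > 0" and "e > 0"
  shows "\<forall>\<^sub>F k in sequentially. \<forall>z\<in>S_section h g A k f. \<exists>y\<in>atomic_section A (semialg h g) f.
    L2_set (\<lambda>\<alpha>. z \<alpha> - y \<alpha>) A \<le> e"
proof (rule ccontr)
  let ?K = "semialg h g"
  let ?C = "atomic_section A ?K f"
  assume "\<not> ?thesis"
  then have bad: "\<exists>k\<ge>N. \<exists>z\<in>S_section h g A k f. \<forall>y\<in>?C. L2_set (\<lambda>\<alpha>. z \<alpha> - y \<alpha>) A > e" for N
    by (auto simp: eventually_sequentially not_le)
  have K: "compact ?K" by (rule compact_semialg[OF arch])
  have cont: "continuous_on ?K (peval p)" for p
    using continuous_on_subset[OF continuous_on_peval] by blast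
  obtain m where m: "m > 0" "\<And>x. x \<in> ?K \<Longrightarrow> peval f x \<ge> m"
    using continuous_attains_inf[OF K ne cont[of f]] pos by blast
  have "\<exists>b. \<forall>x\<in>?K. \<bar>monomial_eval \<alpha> x\<bar> < b * peval f x" for \<alpha>
  proof -
    have "bounded (peval (monomial \<alpha>) ` ?K)"
      using K cont by (intro compact_imp_bounded compact_continuous_image)
    then obtain a where a: "\<And>x. x \<in> ?K \<Longrightarrow> \<bar>monomial_eval \<alpha> x\<bar> \<le> a"
      by (auto simp: bounded_iff peval_monomial)
    \<comment> \<open>The extra 1 makes the bound strict, as
      \<open>valid_inequality_S_section\<close> requires.\<close>
    have "\<bar>monomial_eval \<alpha> x\<bar> < ((\<bar>a\<bar> + 1) / m) * peval f x" if "x \<in> ?K" for x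
    proof -
      have "(\<bar>a\<bar> + 1) / m * m \<le> (\<bar>a\<bar> + 1) / m * peval f x"
        using m that by (intro mult_left_mono) auto
      then show ?thesis using a[OF that] m(1) by simp
    qed
    then show ?thesis by blast
  qed
  then obtain b where b: "\<And>\<alpha> x. x \<in> ?K \<Longrightarrow> \<bar>monomial_eval \<alpha> x\<bar> < b \<alpha> * peval f x" by metis
  have "\<forall>\<^sub>F k in sequentially. \<forall>z\<in>S_section h g A k f. \<bar>z \<alpha>\<bar> \<le> b \<alpha>" if \<alpha>: "\<alpha> \<in> A" for \<alpha>
  proof -
    have delta: "(\<Sum>\<beta>\<in>A. (if \<beta> = \<alpha> then s else 0) * \<phi> \<beta>) = s * \<phi> \<alpha>" for s and \<phi> :: "_ \<Rightarrow> real"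
      using fin \<alpha> by (simp add: if_distrib[of "\<lambda>u. u * _"] cong: if_cong)
    \<comment> \<open>The signs 1 and -1 of \<open>s\<close> give the upper and the lower bound on
      \<open>z \<alpha>\<close>.\<close>
    have "\<forall>\<^sub>F k in sequentially. \<forall>z\<in>S_section h g A k f. s * z \<alpha> \<le> b \<alpha>" if "\<bar>s\<bar> = 1" for s
      unfolding delta[symmetric]
    proof (rule valid_inequality_S_section[OF fin arch span], unfold delta)
      fix x assume "x \<in> ?K"
      moreover have "s * monomial_eval \<alpha> x \<le> \<bar>monomial_eval \<alpha> x\<bar>"
        using that abs_ge_self[of "s * monomial_eval \<alpha> x"] by (simp add: abs_mult)
      ultimately show "s * monomial_eval \<alpha> x < b \<alpha> * peval f x" using b[of x \<alpha>] by simp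
    qed
    from this[of 1] this[of "- 1"] show ?thesis
      by (simp, elim eventually_elim2) (auto simp: abs_le_iff)
  qed
  then have "\<forall>\<^sub>F k in sequentially. \<forall>\<alpha>\<in>A. \<forall>z\<in>S_section h g A k f. \<bar>z \<alpha>\<bar> \<le> b \<alpha>"
    using fin by (intro eventually_ball_finite) auto
  then obtain N where N: "\<And>k z \<alpha>. k \<ge> N \<Longrightarrow> z \<in> S_section h g A k f \<Longrightarrow> \<alpha> \<in> A \<Longrightarrow> \<bar>z \<alpha>\<bar> \<le> b \<alpha>"
    by (auto simp: eventually_sequentially)
  \<comment> \<open>The offset \<open>N\<close> puts every chosen point under the uniform bound, and
    \<open>j\<close> drives the orders to infinity.\<close>
  have "\<exists>k z. k \<ge> N + j \<and> z \<in> S_section h g A k f \<and> (\<forall>y\<in>?C. L2_set (\<lambda>\<alpha>. z \<alpha> - y \<alpha>) A > e)" for j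
    using bad[of "N + j"] by blast
  then obtain k z where k: "\<And>j. k j \<ge> N + j" and z: "\<And>j. z j \<in> S_section h g A (k j) f"
    and far: "\<And>j y. y \<in> ?C \<Longrightarrow> L2_set (\<lambda>\<alpha>. z j \<alpha> - y \<alpha>) A > e"
    by metis
  have "\<bar>z j \<alpha>\<bar> \<le> b \<alpha>" if "\<alpha> \<in> A" for j \<alpha>
    using N[OF _ z that] k[of j] by auto
  then obtain w r where r: "strict_mono r" and w: "\<And>\<alpha>. \<alpha> \<in> A \<Longrightarrow> (\<lambda>j. z (r j) \<alpha>) \<longlonglongrightarrow> w \<alpha>"
    using bounded_vectors_convergent_subsequence[OF fin] by blast
  have far_w: "L2_set (\<lambda>\<alpha>. w \<alpha> - y \<alpha>) A \<ge> e" if "y \<in> ?C" for y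
  proof (rule tendsto_lowerbound)
    show "(\<lambda>j. L2_set (\<lambda>\<alpha>. z (r j) \<alpha> - y \<alpha>) A) \<longlonglongrightarrow> L2_set (\<lambda>\<alpha>. w \<alpha> - y \<alpha>) A"
      unfolding L2_set_def by (intro tendsto_intros w)
  qed (use far[OF that] in \<open>auto intro!: always_eventually less_imp_le\<close>)
  have point: "(\<lambda>\<alpha>\<in>A. monomial_eval \<alpha> x / peval f x) \<in> ?C" if "x \<in> ?K" for x
    using that pos by (intro point_in_atomic_section) auto
  have C_ne: "?C \<noteq> {}" using point ne by blast
  have C_bnd: "\<bar>y \<alpha>\<bar> \<le> b \<alpha>" if "y \<in> ?C" "\<alpha> \<in> A" for y \<alpha>
    by (rule atomic_section_bounded[OF that]) (use b in \<open>auto intro: less_imp_le\<close>)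
  obtain p c where pc: "\<And>y. y \<in> ?C \<Longrightarrow> (\<Sum>\<alpha>\<in>A. p \<alpha> * y \<alpha>) < c" "(\<Sum>\<alpha>\<in>A. p \<alpha> * w \<alpha>) > c"
  proof (rule strict_separation_convex_bounded[where C = ?C and A = A and b = b and e = e and w = w, OF C_ne])
    show "(\<lambda>\<alpha>\<in>A. (1 - t) * y \<alpha> + t * y' \<alpha>) \<in> ?C"
      if "y \<in> ?C" "y' \<in> ?C" "0 \<le> t" "t \<le> 1" for y y' t
      using that by (rule atomic_section_convex)
  qed (erule (1) C_bnd, rule \<open>e > 0\<close>, erule far_w, rule that)
  have "\<forall>\<^sub>F k in sequentially. \<forall>z\<in>S_section h g A k f. (\<Sum>\<alpha>\<in>A. p \<alpha> * z \<alpha>) \<le> c"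
  proof (rule valid_inequality_S_section[OF fin arch span])
    fix x assume x: "x \<in> ?K"
    \<comment> \<open>Separation is applied to the normalised evaluation at \<open>x\<close>;
      multiplying by \<open>peval f x\<close> gives the polynomial inequality.\<close>
    have "(\<Sum>\<alpha>\<in>A. p \<alpha> * monomial_eval \<alpha> x) / peval f x < c"
      using pc(1)[OF point[OF x]] by (simp add: sum_divide_distrib)
    then show "(\<Sum>\<alpha>\<in>A. p \<alpha> * monomial_eval \<alpha> x) < c * peval f x"
      using pos x by (simp add: divide_less_eq)
  qed
  then obtain N' where N': "\<And>k z. k \<ge> N' \<Longrightarrow> z \<in> S_section h g A k f \<Longrightarrow> (\<Sum>\<alpha>\<in>A. p \<alpha> * z \<alpha>) \<le> c"
    by (auto simp: eventually_sequentially)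
  have "(\<Sum>\<alpha>\<in>A. p \<alpha> * w \<alpha>) \<le> c"
  proof (rule tendsto_upperbound)
    show "(\<lambda>j. \<Sum>\<alpha>\<in>A. p \<alpha> * z (r j) \<alpha>) \<longlonglongrightarrow> (\<Sum>\<alpha>\<in>A. p \<alpha> * w \<alpha>)"
      by (intro tendsto_intros w)
    show "\<forall>\<^sub>F j in sequentially. (\<Sum>\<alpha>\<in>A. p \<alpha> * z (r j) \<alpha>) \<le> c"
      using eventually_ge_at_top[of N']
    proof eventually_elim
      case (elim j)
      then have "N' \<le> k (r j)" using k[of "r j"] seq_suble[OF r, of j] by linarith
      then show ?case by (rule N'[OF _ z])
    qed
  qed simp
  then show False using pc(2) by simp
qed

theorem proposition3p4:
  fixes h g :: "'n::finite rpoly list"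
    and A :: "'n expo set"
    and f :: "'n rpoly"
  assumes "semialg h g \<noteq> {}"
    and "finite A"
    and "archimedean h g"
    and "f \<in> poly_span A"
    and "\<forall>x\<in>semialg h g. peval f x > 0"
  shows "(\<lambda>k. set_dist A (S_section h g A k f) (R_section A (semialg h g) f)) \<longlonglongrightarrow> 0"
proof (rule order_tendstoI)
  fix \<epsilon> :: ennreal assume "0 < \<epsilon>"
  \<comment> \<open>An intermediate value is finite even for infinite \<open>\<epsilon>\<close>, and
    it restores the strict inequality after the supremum.\<close>
  then obtain \<delta> where \<delta>: "0 < \<delta>" "\<delta> < \<epsilon>" using dense by blast
  then obtain e where e: "\<delta> = ennreal e" "e > 0"
    by (cases \<delta>) (auto simp: top_unique)
  have "\<forall>\<^sub>F k in sequentially. \<forall>z\<in>S_section h g A k f. \<exists>y\<in>atomic_section A (semialg h g) f.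
      L2_set (\<lambda>\<alpha>. z \<alpha> - y \<alpha>) A \<le> e"
    by (rule eventually_close_to_atomic_section[OF assms e(2)])
  then show "\<forall>\<^sub>F k in sequentially. set_dist A (S_section h g A k f) (R_section A (semialg h g) f) < \<epsilon>"
  proof eventually_elim
    case (elim k)
    have "set_dist A (S_section h g A k f) (R_section A (semialg h g) f) \<le> ennreal e"
      unfolding set_dist_def
    proof (rule SUP_least)
      fix z assume "z \<in> S_section h g A k f"
      then obtain y where "y \<in> R_section A (semialg h g) f" "L2_set (\<lambda>\<alpha>. z \<alpha> - y \<alpha>) A \<le> e"
        using elim atomic_section_subset[OF assms(2,4)] by blast
      then show "(INF y\<in>R_section A (semialg h g) f. ennreal (L2_set (\<lambda>\<alpha>. z \<alpha> - y \<alpha>) A)) \<le> ennreal e"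
        by (intro INF_lower2) (auto intro: ennreal_leI)
    qed
    then show ?case using \<delta>(2) e(1) by simp
  qed
\<comment> \<open>The remaining lower bound is vacuous, as no \<open>ennreal\<close> lies below
  0.\<close>
qed simp

end
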